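(* Let $p$ and $q\ge 3$ be primes with $q$ dividing $p-1$, and let $a\ne b$ and $c\ne d$ be elements of order $q$ in $(\mathbb{Z}/p\mathbb{Z})^\times$. Let $A$ be an abelian group. If $A$ has trivial $p$-torsion, then $B^A(G(a,b))$ and $B^A(G(c,d))$ are isomorphic rings.
   Context: **The groups $G(a,b)$.** Let $p$ and $q\ge3$ be primes with $q\mid p-1$, and let $a\ne b$ be elements of order $q$ in $(\mathbb{Z}/p\mathbb{Z})^\times$. Let $P_a=\mathbb{Z}/p\mathbb{Z}=\langle x\rangle$ and $P_b=\mathbb{Z}/p\mathbb{Z}=\langle y\rangle$ (written additively), and let $Q=\langle z\rangle$ be cyclic of order $q$. Let $Q$ act on $P_a\oplus P_b$ by group automorphisms with ${}^zx=ax$ and ${}^zy=by$. Then $G(a,b)=(P_a\oplus P_b)\rtimes Q$ is the resulting semidirect product, of order $p^2q$. **Fibered Burnside ring.** Let $A$ be an abelian group (written multiplicatively) and $G$ a finite group. $\mathcal{M}^A_G$ is the set of pairs $(K,\phi)$ with $K\le G$ a subgroup and $\phi\colon K\to A$ a group homomorphism. $G$ acts on it by ${}^g(K,\phi)=({}^gK,{}^g\phi)$, where ${}^gK=gKg^{-1}$ and ${}^g\phi(x)=\phi(g^{-1}xg)$ for $x\in{}^gK$; the orbit of $(K,\phi)$ is denoted $[K,\phi]_G$. The $A$-fibered Burnside ring $B^A(G)$ is the Grothendieck ring of the category of $A$-fibered $G$-sets ($G\times A$-sets that are free as $A$-sets with finitely many $A$-orbits), with addition from coproducts and multiplication from the tensor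 product $\otimes_A$. Concretely, it is the free abelian group with basis the set of orbits $G\backslash\mathcal{M}^A_G$ and commutative multiplication $$[K,\phi]_G\cdot[L,\psi]_G=\sum_{KsL\in K\backslash G/L}\bigl[K\cap{}^sL,\ \phi|_{K\cap{}^sL}\cdot{}^s\psi|_{K\cap{}^sL}\bigr]_G,$$ with identity $[G,1]_G$. $A$ has trivial $p$-torsion if the only $\alpha\in A$ with $\alpha^p=1$ is $\alpha=1$. *)

theory Defs
  imports
    "HOL-Algebra.Group_Action"
    "HOL-Algebra.QuotRing"
    "HOL-Algebra.Elementary_Groups"
    "HOL-Algebra.Free_Abelian_Groups"
    "HOL-Number_Theory.Residues"
begin

section \<open>The groups \<open>G(a,b)\<close>\<close>

definition semidirect_product ::
    "('n, 'x) monoid_scheme \<Rightarrow> ('h, 'y) monoid_scheme \<Rightarrow> ('h \<Rightarrow> 'n \<Rightarrow> 'n) \<Rightarrow> ('n \<times> 'h) monoid"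
  where "semidirect_product N H \<theta> =
    \<lparr>carrier = carrier N \<times> carrier H,
     monoid.mult = (\<lambda>(n, h) (n', h'). (n \<otimes>\<^bsub>N\<^esub> \<theta> h n', h \<otimes>\<^bsub>H\<^esub> h')),
     one = (\<one>\<^bsub>N\<^esub>, \<one>\<^bsub>H\<^esub>)\<rparr>"

lemma group_semidirect_product:
  assumes N: "group N" and H: "group H"
    and hom: "\<And>h. h \<in> carrier H \<Longrightarrow> \<theta> h \<in> hom N N"
    and mult: "\<And>h h' n. \<lbrakk>h \<in> carrier H; h' \<in> carrier H; n \<in> carrier N\<rbrakk>
                 \<Longrightarrow> \<theta> (h \<otimes>\<^bsub>H\<^esub> h') n = \<theta> h (\<theta> h' n)"
    and one: "\<And>n. n \<in> carrier N \<Longrightarrow> \<theta> \<one>\<^bsub>H\<^esub> n = n"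
  shows "group (semidirect_product N H \<theta>)"
proof -
  interpret N: group N by fact
  interpret H: group H by fact
  have cl: "\<theta> h n \<in> carrier N" if "h \<in> carrier H" "n \<in> carrier N" for h n
    using hom[OF that(1)] that(2) by (auto simp: hom_def)
  have mu: "\<theta> h (m \<otimes>\<^bsub>N\<^esub> n) = \<theta> h m \<otimes>\<^bsub>N\<^esub> \<theta> h n"
    if "h \<in> carrier H" "m \<in> carrier N" "n \<in> carrier N" for h m n
    using hom[OF that(1)] that(2,3) by (auto simp: hom_def)
  have on: "\<theta> h \<one>\<^bsub>N\<^esub> = \<one>\<^bsub>N\<^esub>" if "h \<in> carrier H" for h
    using hom_one[OF hom[OF that] N N] .
  show ?thesis
  proof (rule groupI)
    fix x assume "x \<in> carrier (semidirect_product N H \<theta>)"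
    then obtain n h where x: "x = (n, h)" "n \<in> carrier N" "h \<in> carrier H"
      by (auto simp: semidirect_product_def)
    let ?y = "(\<theta> (inv\<^bsub>H\<^esub> h) (inv\<^bsub>N\<^esub> n), inv\<^bsub>H\<^esub> h)"
    have "\<theta> (inv\<^bsub>H\<^esub> h) (inv\<^bsub>N\<^esub> n) \<otimes>\<^bsub>N\<^esub> \<theta> (inv\<^bsub>H\<^esub> h) n = \<one>\<^bsub>N\<^esub>"
      using x mu[of "inv\<^bsub>H\<^esub> h" "inv\<^bsub>N\<^esub> n" n] on by simp
    then show "\<exists>y\<in>carrier (semidirect_product N H \<theta>).
        y \<otimes>\<^bsub>semidirect_product N H \<theta>\<^esub> x = \<one>\<^bsub>semidirect_product N H \<theta>\<^esub>"
      using x cl by (intro bexI[of _ ?y]) (auto simp: semidirect_product_def)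
  qed (auto simp: semidirect_product_def cl mu mult one on N.m_assoc H.m_assoc)
qed

text \<open>
  Here \<open>P\<^sub>a\<close> and \<open>P\<^sub>b\<close> are both the additive group of \<^term>\<open>residue_ring (int p)\<close>, the group
  \<open>Q\<close> is \<^term>\<open>integer_mod_group q\<close> with generator \<open>z = 1\<close>, and the element \<open>i\<close> of \<open>Q\<close>, i.e.
  \<open>z\<^sup>i\<close>, acts by \<open>(x, y) \<mapsto> (a\<^sup>i x, b\<^sup>i y)\<close>.
\<close>

definition G_action :: "nat \<Rightarrow> int \<Rightarrow> int \<Rightarrow> int \<Rightarrow> int \<times> int \<Rightarrow> int \<times> int"
  where "G_action p a b i = (let R = residue_ring (int p) in
    (\<lambda>(x, y). ((a [^]\<^bsub>R\<^esub> nat i) \<otimes>\<^bsub>R\<^esub> x, (b [^]\<^bsub>R\<^esub> nat i) \<otimes>\<^bsub>R\<^esub> y)))"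

definition G_group :: "nat \<Rightarrow> nat \<Rightarrow> int \<Rightarrow> int \<Rightarrow> ((int \<times> int) \<times> int) monoid"
  where "G_group p q a b =
    semidirect_product
      (add_monoid (residue_ring (int p)) \<times>\<times> add_monoid (residue_ring (int p)))
      (integer_mod_group q)
      (G_action p a b)"

lemma group_G_group:
  assumes p: "prime p" and q: "prime q"
    and a: "a \<in> Units (residue_ring (int p))" "group.ord (units_of (residue_ring (int p))) a = q"
    and b: "b \<in> Units (residue_ring (int p))" "group.ord (units_of (residue_ring (int p))) b = q"
  shows "group (G_group p q a b)"
proof -
  let ?R = "residue_ring (int p)"
  interpret R: residues "int p" ?R
    using prime_gt_1_nat[OF p] by unfold_locales auto
  interpret U: group "units_of ?R" by (rule R.units_group)
  have ac: "a \<in> carrier ?R" "b \<in> carrier ?R" using a b by auto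
  have pow: "u [^]\<^bsub>?R\<^esub> nat ((i + j) mod int q) = u [^]\<^bsub>?R\<^esub> nat i \<otimes>\<^bsub>?R\<^esub> u [^]\<^bsub>?R\<^esub> nat j"
    if u: "u \<in> Units ?R" "U.ord u = q" and ij: "0 \<le> i" "0 \<le> j" for u i j
  proof -
    have uc: "u \<in> carrier (units_of ?R)" "u \<in> carrier ?R" using u by (auto simp: units_of_carrier)
    have e: "u [^]\<^bsub>?R\<^esub> q = \<one>\<^bsub>?R\<^esub>"
      using U.pow_ord_eq_1[OF uc(1)] u by (simp add: R.units_of_pow units_of_one)
    have n: "nat ((i + j) mod int q) = (nat i + nat j) mod q"
      using ij by (simp add: nat_mod_distrib nat_add_distrib)
    have "u [^]\<^bsub>?R\<^esub> (nat i + nat j) = u [^]\<^bsub>?R\<^esub> (q * ((nat i + nat j) div q) + (nat i + nat j) mod q)"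
      by simp
    also have "\<dots> = u [^]\<^bsub>?R\<^esub> ((nat i + nat j) mod q)"
      using uc e by (simp only: R.nat_pow_mult[symmetric] R.nat_pow_pow[symmetric]) simp
    finally show ?thesis using n uc by (simp add: R.nat_pow_mult)
  qed
  have Q: "carrier (integer_mod_group q) = {0..<int q}"
      "\<And>x y. x \<otimes>\<^bsub>integer_mod_group q\<^esub> y = (x + y) mod int q" "\<one>\<^bsub>integer_mod_group q\<^esub> = 0"
    using prime_gt_0_nat[OF q] by (auto simp: integer_mod_group_def)
  show ?thesis
    unfolding G_group_def
  proof (rule group_semidirect_product)
    show "group (add_monoid ?R \<times>\<times> add_monoid ?R)"
      using DirProd_group R.add.is_group by blast
    show "group (integer_mod_group q)" by simp
    show "G_action p a b h \<in> hom (add_monoid ?R \<times>\<times> add_monoid ?R) (add_monoid ?R \<times>\<times> add_monoid ?R)"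
      if "h \<in> carrier (integer_mod_group q)" for h
      using ac by (auto simp: hom_def G_action_def Let_def DirProd_def R.r_distr)
    show "G_action p a b (h \<otimes>\<^bsub>integer_mod_group q\<^esub> h') n = G_action p a b h (G_action p a b h' n)"
      if "h \<in> carrier (integer_mod_group q)" "h' \<in> carrier (integer_mod_group q)"
        "n \<in> carrier (add_monoid ?R \<times>\<times> add_monoid ?R)" for h h' n
      using that ac pow[OF a, of h h'] pow[OF b, of h h']
      by (auto simp: G_action_def Let_def Q DirProd_def R.m_assoc simp del: pow_nat)
    show "G_action p a b \<one>\<^bsub>integer_mod_group q\<^esub> n = n"
      if "n \<in> carrier (add_monoid ?R \<times>\<times> add_monoid ?R)" for n
      using that by (auto simp: G_action_def Let_def Q DirProd_def)
  qed
qed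

lemma order_G_group:
  assumes "prime p" "prime q"
  shows "order (G_group p q a b) = p\<^sup>2 * q"
  using prime_gt_0_nat[OF assms(2)]
  by (simp add: order_def G_group_def semidirect_product_def DirProd_def residue_ring_def
      integer_mod_group_def card_cartesian_product power2_eq_square)


section \<open>The fibered Burnside ring\<close>

text \<open>
  A homomorphism \<open>K \<rightarrow> A\<close> is represented by a function that is \<^const>\<open>undefined\<close> outside \<open>K\<close>, so
  that equal homomorphisms are equal as functions.
\<close>

definition fib_pairs ::
    "('g, 'x) monoid_scheme \<Rightarrow> ('a, 'y) monoid_scheme \<Rightarrow> ('g set \<times> ('g \<Rightarrow> 'a)) set"
  where "fib_pairs G A =
    {(K, \<phi>). subgroup K G \<and> \<phi> \<in> hom (G\<lparr>carrier := K\<rparr>) A \<and> \<phi> \<in> extensional K}"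

definition conj_set :: "('g, 'x) monoid_scheme \<Rightarrow> 'g \<Rightarrow> 'g set \<Rightarrow> 'g set"
  where "conj_set G g K = (\<lambda>k. g \<otimes>\<^bsub>G\<^esub> k \<otimes>\<^bsub>G\<^esub> inv\<^bsub>G\<^esub> g) ` K"

definition fib_conj ::
    "('g, 'x) monoid_scheme \<Rightarrow> 'g \<Rightarrow> 'g set \<times> ('g \<Rightarrow> 'a) \<Rightarrow> 'g set \<times> ('g \<Rightarrow> 'a)"
  where "fib_conj G g = (\<lambda>(K, \<phi>).
    (conj_set G g K, \<lambda>x\<in>conj_set G g K. \<phi> (inv\<^bsub>G\<^esub> g \<otimes>\<^bsub>G\<^esub> x \<otimes>\<^bsub>G\<^esub> g)))"

abbreviation fib_orbit ::
    "('g, 'x) monoid_scheme \<Rightarrow> 'g set \<times> ('g \<Rightarrow> 'a) \<Rightarrow> ('g set \<times> ('g \<Rightarrow> 'a)) set"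
  where "fib_orbit G x \<equiv> orbit G (fib_conj G) x"

abbreviation fib_orbits ::
    "('g, 'x) monoid_scheme \<Rightarrow> ('a, 'y) monoid_scheme \<Rightarrow> ('g set \<times> ('g \<Rightarrow> 'a)) set set"
  where "fib_orbits G A \<equiv> orbits G (fib_pairs G A) (fib_conj G)"

definition fib_meet ::
    "('a, 'y) monoid_scheme \<Rightarrow> 'g set \<times> ('g \<Rightarrow> 'a) \<Rightarrow> 'g set \<times> ('g \<Rightarrow> 'a) \<Rightarrow> 'g set \<times> ('g \<Rightarrow> 'a)"
  where "fib_meet A = (\<lambda>(K, \<phi>) (L, \<psi>). (K \<inter> L, \<lambda>x\<in>K \<inter> L. \<phi> x \<otimes>\<^bsub>A\<^esub> \<psi> x))"

definition double_cosets :: "('g, 'x) monoid_scheme \<Rightarrow> 'g set \<Rightarrow> 'g set \<Rightarrow> 'g set set"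
  where "double_cosets G K L = (\<lambda>s. (K #>\<^bsub>G\<^esub> s) <#>\<^bsub>G\<^esub> L) ` carrier G"

text \<open>
  The right-hand side of the multiplication formula, for given \<open>x = (K, \<phi>)\<close> and \<open>y = (L, \<psi>)\<close>, with
  a chosen representative \<open>s\<close> of each double coset.  The formula on orbits then uses chosen
  representatives of the orbits.  By \<open>fib_orbit_mult_eq\<close> below, neither choice matters.
\<close>

definition fib_pair_mult ::
    "('g, 'x) monoid_scheme \<Rightarrow> ('a, 'y) monoid_scheme \<Rightarrow> 'g set \<times> ('g \<Rightarrow> 'a) \<Rightarrow>
     'g set \<times> ('g \<Rightarrow> 'a) \<Rightarrow> ('g set \<times> ('g \<Rightarrow> 'a)) set \<Rightarrow>\<^sub>0 int"
  where "fib_pair_mult G A x y =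
    (\<Sum>D\<in>double_cosets G (fst x) (fst y).
       frag_of (fib_orbit G (fib_meet A x (fib_conj G (SOME s. s \<in> D) y))))"

definition fib_orbit_mult ::
    "('g, 'x) monoid_scheme \<Rightarrow> ('a, 'y) monoid_scheme \<Rightarrow> ('g set \<times> ('g \<Rightarrow> 'a)) set \<Rightarrow>
     ('g set \<times> ('g \<Rightarrow> 'a)) set \<Rightarrow> ('g set \<times> ('g \<Rightarrow> 'a)) set \<Rightarrow>\<^sub>0 int"
  where "fib_orbit_mult G A X Y = fib_pair_mult G A (SOME x. x \<in> X) (SOME y. y \<in> Y)"

definition fibered_Burnside_ring ::
    "('a, 'y) monoid_scheme \<Rightarrow> ('g, 'x) monoid_scheme \<Rightarrow> (('g set \<times> ('g \<Rightarrow> 'a)) set \<Rightarrow>\<^sub>0 int) ring"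
  where "fibered_Burnside_ring A G =
    \<lparr>carrier = carrier (free_Abelian_group (fib_orbits G A)),
     monoid.mult = (\<lambda>u v. frag_extend (\<lambda>X. frag_extend (\<lambda>Y. fib_orbit_mult G A X Y) v) u),
     one = frag_of (fib_orbit G (carrier G, \<lambda>x\<in>carrier G. \<one>\<^bsub>A\<^esub>)),
     ring.zero = 0,
     ring.add = (+)\<rparr>"

context group
begin

lemma group_cancel:
  assumes "g \<in> carrier G" "x \<in> carrier G"
  shows "g \<otimes> (inv g \<otimes> x) = x" "inv g \<otimes> (g \<otimes> x) = x"
  using assms by (simp_all flip: m_assoc)

lemma conj_set_iff:
  assumes "g \<in> carrier G" "K \<subseteq> carrier G"
  shows "x \<in> conj_set G g K \<longleftrightarrow> x \<in> carrier G \<and> inv g \<otimes> x \<otimes> g \<in> K"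
proof
  assume "x \<in> conj_set G g K"
  then obtain k where k: "k \<in> K" "x = g \<otimes> k \<otimes> inv g" by (auto simp: conj_set_def)
  then have kc: "k \<in> carrier G" using assms by auto
  have "inv g \<otimes> x \<otimes> g = k"
    using k kc assms by (simp add: m_assoc group_cancel)
  then show "x \<in> carrier G \<and> inv g \<otimes> x \<otimes> g \<in> K" using k kc assms by auto
next
  assume x: "x \<in> carrier G \<and> inv g \<otimes> x \<otimes> g \<in> K"
  have "g \<otimes> (inv g \<otimes> x \<otimes> g) \<otimes> inv g = x"
    using x assms by (simp add: m_assoc group_cancel)
  then show "x \<in> conj_set G g K"
    using x unfolding conj_set_def by (metis imageI)
qed

lemma fib_conj_mult:
  assumes "g \<in> carrier G" "h \<in> carrier G" "fst x \<subseteq> carrier G"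
  shows "fib_conj G g (fib_conj G h x) = fib_conj G (g \<otimes> h) x"
proof -
  obtain K \<phi> where x: "x = (K, \<phi>)" by (cases x)
  have K: "K \<subseteq> carrier G" using assms x by simp
  have sub: "conj_set G h K \<subseteq> carrier G" using assms K by (auto simp: conj_set_iff)
  have eq: "inv h \<otimes> (inv g \<otimes> z \<otimes> g) \<otimes> h = inv (g \<otimes> h) \<otimes> z \<otimes> (g \<otimes> h)" if "z \<in> carrier G" for z
    using that assms by (simp add: inv_mult_group m_assoc)
  have set: "conj_set G g (conj_set G h K) = conj_set G (g \<otimes> h) K"
    using assms K sub by (auto simp: conj_set_iff eq)
  have car: "z \<in> carrier G" "inv g \<otimes> z \<otimes> g \<in> conj_set G h K" if "z \<in> conj_set G (g \<otimes> h) K" for z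
    using that assms sub unfolding set[symmetric] by (auto simp: conj_set_iff)
  show ?thesis
    unfolding x fib_conj_def by (auto simp: set eq car intro!: restrict_ext)
qed

lemma fib_conj_meet:
  assumes "g \<in> carrier G" "fst x \<subseteq> carrier G" "fst y \<subseteq> carrier G"
  shows "fib_conj G g (fib_meet A x y) = fib_meet A (fib_conj G g x) (fib_conj G g y)"
proof -
  obtain K \<phi> L \<psi> where xy: "x = (K, \<phi>)" "y = (L, \<psi>)" by (cases x, cases y)
  have KL: "K \<subseteq> carrier G" "L \<subseteq> carrier G" "K \<inter> L \<subseteq> carrier G" using assms xy by auto
  have "conj_set G g (K \<inter> L) = conj_set G g K \<inter> conj_set G g L"
    using assms KL by (auto simp: conj_set_iff)
  then show ?thesis
    using assms KL unfolding xy fib_conj_def fib_meet_def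
    by (auto simp: conj_set_iff intro!: restrict_ext)
qed

lemma fib_conj_subset: "g \<in> carrier G \<Longrightarrow> fst x \<subseteq> carrier G \<Longrightarrow> fst (fib_conj G g x) \<subseteq> carrier G"
  by (auto simp: fib_conj_def conj_set_iff split: prod.splits)

lemma fib_pairs_subset: "x \<in> fib_pairs G A \<Longrightarrow> fst x \<subseteq> carrier G"
  unfolding fib_pairs_def using subgroup.subset by fastforce

lemma fib_orbit_conj:
  assumes g: "g \<in> carrier G" and x: "fst x \<subseteq> carrier G"
  shows "fib_orbit G (fib_conj G g x) = fib_orbit G x"
proof -
  have "fib_conj G h (fib_conj G g x) \<in> fib_orbit G x" if "h \<in> carrier G" for h
    using that g x by (auto simp: fib_conj_mult orbit_def)
  moreover have "fib_conj G h x \<in> fib_orbit G (fib_conj G g x)" if "h \<in> carrier G" for h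
  proof -
    have "fib_conj G h x = fib_conj G (h \<otimes> inv g) (fib_conj G g x)"
      using that g x by (simp add: fib_conj_mult m_assoc)
    then show ?thesis using that g by (auto simp: orbit_def)
  qed
  ultimately show ?thesis unfolding orbit_def by auto
qed

lemma fib_conj_self:
  assumes A: "comm_group A" and x: "x \<in> fib_pairs G A" and g: "g \<in> fst x"
  shows "fib_conj G g x = x"
proof -
  obtain K \<phi> where x': "x = (K, \<phi>)" "subgroup K G" "\<phi> \<in> hom (G\<lparr>carrier := K\<rparr>) A" "\<phi> \<in> extensional K"
    using x by (auto simp: fib_pairs_def)
  interpret A: comm_group A by fact
  interpret K: subgroup K G by fact
  have gK: "g \<in> K" using g x' by simp
  have mu: "\<phi> (k \<otimes> l) = \<phi> k \<otimes>\<^bsub>A\<^esub> \<phi> l" "\<phi> k \<in> carrier A" if "k \<in> K" "l \<in> K" for k l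
    using x'(3) that by (auto simp: hom_def)
  have set: "conj_set G g K = K"
  proof -
    have in_K: "z \<in> K" if z: "z \<in> carrier G" "inv g \<otimes> z \<otimes> g \<in> K" for z
    proof -
      have "g \<otimes> (inv g \<otimes> z \<otimes> g) \<otimes> inv g \<in> K"
        by (rule K.m_closed[OF K.m_closed[OF gK z(2)] K.m_inv_closed[OF gK]])
      moreover have "g \<otimes> (inv g \<otimes> z \<otimes> g) \<otimes> inv g = z"
        using z(1) gK by (simp add: m_assoc group_cancel)
      ultimately show ?thesis by simp
    qed
    show ?thesis
    proof (intro equalityI subsetI)
      fix z assume "z \<in> conj_set G g K"
      then show "z \<in> K" using gK in_K[of z] by (simp add: conj_set_iff K.subset)
    next
      fix z assume "z \<in> K"
      then show "z \<in> conj_set G g K" using gK by (simp add: conj_set_iff K.subset)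
    qed
  qed
  have "\<phi> (inv g \<otimes> z \<otimes> g) = \<phi> z" if "z \<in> K" for z
  proof -
    have i: "inv g \<in> K" using gK by simp
    have "\<phi> (inv g \<otimes> z \<otimes> g) = \<phi> (inv g) \<otimes>\<^bsub>A\<^esub> \<phi> z \<otimes>\<^bsub>A\<^esub> \<phi> g"
      using mu(1)[OF K.m_closed[OF i that] gK] mu(1)[OF i that] by simp
    also have "\<dots> = \<phi> (inv g) \<otimes>\<^bsub>A\<^esub> \<phi> g \<otimes>\<^bsub>A\<^esub> \<phi> z"
      using mu(2)[OF i i] mu(2)[OF that that] mu(2)[OF gK gK]
      by (simp add: A.m_assoc A.m_comm[of "\<phi> z" "\<phi> g"])
    also have "\<dots> = \<phi> (inv g \<otimes> g \<otimes> z)"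
      using mu(1)[OF K.m_closed[OF i gK] that] mu(1)[OF i gK] by simp
    also have "inv g \<otimes> g \<otimes> z = z" using that gK by simp
    finally show ?thesis .
  qed
  then show ?thesis
    using x'(4) unfolding x' fib_conj_def
    using set by (auto simp: fun_eq_iff extensional_def restrict_def)
qed

lemma fib_meet_conj_conj:
  assumes "g \<in> carrier G" "h \<in> carrier G" "s \<in> carrier G" "fst x \<subseteq> carrier G" "fst y \<subseteq> carrier G"
  shows "fib_orbit G (fib_meet A (fib_conj G g x) (fib_conj G s (fib_conj G h y))) =
         fib_orbit G (fib_meet A x (fib_conj G (inv g \<otimes> s \<otimes> h) y))"
proof -
  have "fib_conj G s (fib_conj G h y) = fib_conj G g (fib_conj G (inv g \<otimes> s \<otimes> h) y)"
    using assms by (simp add: fib_conj_mult m_assoc group_cancel)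
  then have "fib_meet A (fib_conj G g x) (fib_conj G s (fib_conj G h y)) =
      fib_conj G g (fib_meet A x (fib_conj G (inv g \<otimes> s \<otimes> h) y))"
    using assms by (simp add: fib_conj_meet fib_conj_subset)
  moreover have "fst (fib_meet A x z) \<subseteq> carrier G" for z
    using assms by (auto simp: fib_meet_def split: prod.splits)
  ultimately show ?thesis using assms by (simp add: fib_orbit_conj)
qed

lemma double_coset_mem:
  assumes "K \<subseteq> carrier G" "L \<subseteq> carrier G" "s \<in> carrier G"
  shows "t \<in> (K #> s) <#> L \<longleftrightarrow> (\<exists>k\<in>K. \<exists>l\<in>L. t = k \<otimes> s \<otimes> l)"
  by (auto simp: r_coset_def set_mult_def)

lemma fib_meet_double_coset:
  assumes A: "comm_group A" and x: "x \<in> fib_pairs G A" and y: "y \<in> fib_pairs G A"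
    and s: "s \<in> carrier G" and t: "t \<in> (fst x #> s) <#> fst y"
  shows "fib_orbit G (fib_meet A x (fib_conj G t y)) = fib_orbit G (fib_meet A x (fib_conj G s y))"
proof -
  have sub: "fst x \<subseteq> carrier G" "fst y \<subseteq> carrier G" using x y fib_pairs_subset by blast+
  obtain k l where kl: "k \<in> fst x" "l \<in> fst y" "t = k \<otimes> s \<otimes> l"
    using t sub s by (auto simp: double_coset_mem)
  then have c: "k \<in> carrier G" "l \<in> carrier G" using sub by auto
  then have "inv k \<otimes> t \<otimes> inv l = s" 
    using kl(3) s by (simp add: m_assoc group_cancel)
  moreover have "inv l \<in> fst y"
    using y kl(2) by (auto simp: fib_pairs_def subgroup.m_inv_closed)
  ultimately show ?thesis
    using fib_meet_conj_conj[of k "inv l" t x y A] kl c s sub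
      fib_conj_self[OF A x kl(1)] fib_conj_self[OF A y, of "inv l"] by simp
qed

lemma fib_pair_mult_eq:
  assumes A: "comm_group A" and x: "x \<in> fib_pairs G A" and y: "y \<in> fib_pairs G A"
    and r: "\<And>D. D \<in> double_cosets G (fst x) (fst y) \<Longrightarrow> r D \<in> D"
  shows "fib_pair_mult G A x y =
    (\<Sum>D\<in>double_cosets G (fst x) (fst y). frag_of (fib_orbit G (fib_meet A x (fib_conj G (r D) y))))"
  unfolding fib_pair_mult_def
proof (rule sum.cong[OF refl])
  fix D assume D: "D \<in> double_cosets G (fst x) (fst y)"
  then obtain s where s: "s \<in> carrier G" "D = (fst x #> s) <#> fst y"
    by (auto simp: double_cosets_def)
  have "(SOME s. s \<in> D) \<in> D" using r[OF D] by (rule someI)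
  then show "frag_of (fib_orbit G (fib_meet A x (fib_conj G (SOME s. s \<in> D) y))) =
      frag_of (fib_orbit G (fib_meet A x (fib_conj G (r D) y)))"
    using fib_meet_double_coset[OF A x y s(1)] r[OF D] s by (simp add: frag_of_eq)
qed

lemma fib_conj_pairs:
  assumes A: "comm_group A" and x: "x \<in> fib_pairs G A" and g: "g \<in> carrier G"
  shows "fib_conj G g x \<in> fib_pairs G A"
proof -
  obtain K \<phi> where x': "x = (K, \<phi>)" "subgroup K G" "\<phi> \<in> hom (G\<lparr>carrier := K\<rparr>) A" "\<phi> \<in> extensional K"
    using x by (auto simp: fib_pairs_def)
  interpret K: subgroup K G by fact
  have m: "inv g \<otimes> (z \<otimes> w) \<otimes> g = (inv g \<otimes> z \<otimes> g) \<otimes> (inv g \<otimes> w \<otimes> g)"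
    if "z \<in> carrier G" "w \<in> carrier G" for z w
    using that g by (simp add: m_assoc group_cancel)
  have i: "inv g \<otimes> inv z \<otimes> g = inv (inv g \<otimes> z \<otimes> g)" if "z \<in> carrier G" for z
    using that g by (simp add: inv_mult_group m_assoc)
  have 1: "subgroup (conj_set G g K) G"
    using g by (auto intro!: subgroup.intro simp: conj_set_iff K.subset m i)
  have "(\<lambda>z\<in>conj_set G g K. \<phi> (inv g \<otimes> z \<otimes> g)) \<in> hom (G\<lparr>carrier := conj_set G g K\<rparr>) A"
    using x'(3) g subgroup.m_closed[OF 1] by (auto simp: hom_def conj_set_iff K.subset m)
  then show ?thesis using 1 by (auto simp: x' fib_conj_def fib_pairs_def)
qed

lemma fib_pair_mult_conj:
  assumes A: "comm_group A" and x: "x \<in> fib_pairs G A" and y: "y \<in> fib_pairs G A"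
    and g: "g \<in> carrier G" and h: "h \<in> carrier G"
  shows "fib_pair_mult G A (fib_conj G g x) (fib_conj G h y) = fib_pair_mult G A x y"
proof -
  obtain K \<phi> L \<psi> where xy: "x = (K, \<phi>)" "y = (L, \<psi>)" by (cases x, cases y)
  have sub: "K \<subseteq> carrier G" "L \<subseteq> carrier G" "subgroup K G" "subgroup L G"
    using x y xy by (auto simp: fib_pairs_def dest: subgroup.subset)
  let ?K = "conj_set G g K" and ?L = "conj_set G h L"
  let ?x = "fib_conj G g x" and ?y = "fib_conj G h y"
  have sub': "?K \<subseteq> carrier G" "?L \<subseteq> carrier G" using sub g h by (auto simp: conj_set_iff)
  let ?f = "\<lambda>D. (\<lambda>s. g \<otimes> s \<otimes> inv h) ` D"
  have f: "?f ((K #> s) <#> L) = (?K #> (g \<otimes> s \<otimes> inv h)) <#> ?L" if s: "s \<in> carrier G" for s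
  proof -
    have e: "g \<otimes> k \<otimes> inv g \<otimes> (g \<otimes> s \<otimes> inv h) \<otimes> (h \<otimes> l \<otimes> inv h) = g \<otimes> (k \<otimes> s \<otimes> l) \<otimes> inv h"
      if "k \<in> K" "l \<in> L" for k l
    proof -
      have "k \<in> carrier G" "l \<in> carrier G" using that sub by auto
      then show ?thesis using g h s by (simp add: m_assoc group_cancel)
    qed
    show ?thesis
    proof (rule Set.set_eqI)
      fix t
      have "t \<in> (?K #> (g \<otimes> s \<otimes> inv h)) <#> ?L \<longleftrightarrow>
          (\<exists>k\<in>K. \<exists>l\<in>L. t = g \<otimes> k \<otimes> inv g \<otimes> (g \<otimes> s \<otimes> inv h) \<otimes> (h \<otimes> l \<otimes> inv h))"
        by (simp add: r_coset_def set_mult_def conj_set_def)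
      also have "\<dots> \<longleftrightarrow> (\<exists>k\<in>K. \<exists>l\<in>L. t = g \<otimes> (k \<otimes> s \<otimes> l) \<otimes> inv h)"
        by (intro bex_cong refl) (simp only: e)
      also have "\<dots> \<longleftrightarrow> t \<in> ?f ((K #> s) <#> L)"
        by (simp add: r_coset_def set_mult_def image_iff)
      finally show "t \<in> ?f ((K #> s) <#> L) \<longleftrightarrow> t \<in> (?K #> (g \<otimes> s \<otimes> inv h)) <#> ?L" by simp
    qed
  qed
  have ne: "(SOME s. s \<in> D) \<in> D \<and> D \<subseteq> carrier G" if D: "D \<in> double_cosets G K L" for D
  proof -
    obtain s where s: "s \<in> carrier G" "D = (K #> s) <#> L" using D unfolding double_cosets_def by blast
    have "\<one> \<otimes> s \<otimes> \<one> \<in> D"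
      unfolding s(2) double_coset_mem[OF sub(1,2) s(1)]
      using subgroup.one_closed[OF sub(3)] subgroup.one_closed[OF sub(4)] by blast
    then have 1: "(SOME s. s \<in> D) \<in> D" by (rule someI)
    have 2: "D \<subseteq> carrier G"
    proof
      fix t assume "t \<in> D"
      then obtain k l where "k \<in> K" "l \<in> L" "t = k \<otimes> s \<otimes> l"
        unfolding s(2) double_coset_mem[OF sub(1,2) s(1)] by blast
      then show "t \<in> carrier G" using s(1) sub(1,2) by auto
    qed
    from 1 2 show ?thesis ..
  qed
  have inj: "inj_on (\<lambda>s. g \<otimes> s \<otimes> inv h) (carrier G)"
    using g h by (intro inj_onI) simp
  have img: "double_cosets G ?K ?L = ?f ` double_cosets G K L"
  proof -
    have G: "carrier G = (\<lambda>s. g \<otimes> s \<otimes> inv h) ` carrier G"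
    proof (intro equalityI subsetI)
      fix z assume z: "z \<in> carrier G"
      have "z = g \<otimes> (inv g \<otimes> z \<otimes> h) \<otimes> inv h"
        using z g h by (simp add: m_assoc group_cancel)
      then show "z \<in> (\<lambda>s. g \<otimes> s \<otimes> inv h) ` carrier G"
        by (rule image_eqI) (use z g h in simp)
    qed (use g h in auto)
    have "double_cosets G ?K ?L =
        (\<lambda>s. (?K #> s) <#> ?L) ` (\<lambda>s. g \<otimes> s \<otimes> inv h) ` carrier G"
      unfolding double_cosets_def by (subst G) (rule refl)
    also have "\<dots> = ?f ` double_cosets G K L"
      unfolding double_cosets_def image_image using f by (intro image_cong) simp_all
    finally show ?thesis .
  qed
  have injf: "inj_on ?f (double_cosets G K L)"
  proof (rule inj_onI)
    fix D E assume D: "D \<in> double_cosets G K L" "E \<in> double_cosets G K L" "?f D = ?f E"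
    show "D = E"
      using inj_on_image_eq_iff[OF inj, of D E] ne[OF D(1)] ne[OF D(2)] D(3) by blast
  qed
  define r where "r D = g \<otimes> (SOME s. s \<in> the_inv_into (double_cosets G K L) ?f D) \<otimes> inv h" for D
  have rf: "r (?f D) = g \<otimes> (SOME s. s \<in> D) \<otimes> inv h" if "D \<in> double_cosets G K L" for D
    unfolding r_def using the_inv_into_f_f[OF injf that] by simp
  have fst': "fst ?x = ?K" "fst ?y = ?L" "fst x = K" "fst y = L" by (auto simp: xy fib_conj_def)
  have r: "r D \<in> D" if D: "D \<in> double_cosets G ?K ?L" for D
  proof -
    obtain E where E: "D = ?f E" "E \<in> double_cosets G K L" using D unfolding img by (rule imageE)
    show ?thesis unfolding E(1) rf[OF E(2)] using ne[OF E(2)] by blast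
  qed
  have "fib_pair_mult G A ?x ?y =
      (\<Sum>D\<in>double_cosets G ?K ?L. frag_of (fib_orbit G (fib_meet A ?x (fib_conj G (r D) ?y))))"
    using fib_pair_mult_eq[OF A fib_conj_pairs[OF A x g] fib_conj_pairs[OF A y h], of r]
    unfolding fst' using r by blast
  also have "\<dots> = (\<Sum>D\<in>double_cosets G K L.
      frag_of (fib_orbit G (fib_meet A ?x (fib_conj G (g \<otimes> (SOME s. s \<in> D) \<otimes> inv h) ?y))))"
    unfolding img sum.reindex[OF injf] o_def using rf by (intro sum.cong refl) simp
  also have "\<dots> = fib_pair_mult G A x y"
    unfolding fib_pair_mult_def fst'
  proof (rule sum.cong[OF refl])
    fix D assume D: "D \<in> double_cosets G K L"
    define s where "s = (SOME s. s \<in> D)"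
    have s: "s \<in> carrier G" using ne[OF D] by (auto simp: s_def)
    have e: "inv g \<otimes> (g \<otimes> s \<otimes> inv h) \<otimes> h = s"
      using g h s by (simp add: m_assoc group_cancel)
    show "frag_of (fib_orbit G (fib_meet A ?x (fib_conj G (g \<otimes> (SOME s. s \<in> D) \<otimes> inv h) ?y))) =
        frag_of (fib_orbit G (fib_meet A x (fib_conj G (SOME s. s \<in> D) y)))"
      using fib_meet_conj_conj[of g h "g \<otimes> s \<otimes> inv h" x y A] g h s sub
      by (simp add: e fst' flip: s_def)
  qed
  finally show ?thesis .
qed

theorem fib_orbit_mult_eq:
  assumes A: "comm_group A" and x: "x \<in> fib_pairs G A" and y: "y \<in> fib_pairs G A"
    and r: "\<And>D. D \<in> double_cosets G (fst x) (fst y) \<Longrightarrow> r D \<in> D"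
  shows "fib_orbit_mult G A (fib_orbit G x) (fib_orbit G y) =
    (\<Sum>D\<in>double_cosets G (fst x) (fst y). frag_of (fib_orbit G (fib_meet A x (fib_conj G (r D) y))))"
proof -
  have rep: "\<exists>g\<in>carrier G. (SOME w. w \<in> fib_orbit G z) = fib_conj G g z" for z :: "'a set \<times> ('a \<Rightarrow> 'c)"
  proof -
    have "fib_conj G \<one> z \<in> fib_orbit G z" by (auto simp: orbit_def)
    then have "(SOME w. w \<in> fib_orbit G z) \<in> fib_orbit G z" by (rule someI)
    then show ?thesis by (auto simp: orbit_def)
  qed
  obtain g h where "g \<in> carrier G" "h \<in> carrier G"
    "(SOME w. w \<in> fib_orbit G x) = fib_conj G g x" "(SOME w. w \<in> fib_orbit G y) = fib_conj G h y"
    using rep[of x] rep[of y] by blast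
  then show ?thesis
    using fib_pair_mult_conj[OF A x y] fib_pair_mult_eq[OF A x y r]
    by (simp add: fib_orbit_mult_def)
qed

end

end

theory Submission
  imports Defs
begin

text \<open>
  Write \<open>V = P\<^sub>a \<oplus> P\<^sub>b\<close>.  As \<open>A\<close> has trivial \<open>p\<close>-torsion, a homomorphism from a subgroup \<open>K\<close> of \<open>G(a,b)\<close>
  to \<open>A\<close> is trivial on \<open>K \<inter> V\<close>.  So the pairs \<open>(K, \<phi>)\<close> are of two kinds (\<open>fib_pairs_cases\<close>): either
  \<open>K \<le> V\<close> and \<open>\<phi> = 1\<close>, or \<open>K\<close> is the conjugate of \<open>U Q\<close> by some \<open>v \<in> V\<close>, where \<open>U \<le> V\<close> is stable under all
  diagonal matrices, and \<open>\<phi>\<close> comes from a homomorphism \<open>Q \<rightarrow> A\<close>.  The orbit of a pair of the second kind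
  is obtained by letting \<open>v\<close> vary over \<open>V\<close>, and \<open>G(a,b)\<close> acts on the pairs of the first kind through
  the action of \<open>z\<close> on the lines of \<open>V\<close>, which depends only on \<open>b / a\<close>.

  Since \<open>b / a\<close> and \<open>d / c\<close> both generate the group of \<open>q\<close>-th roots of unity modulo \<open>p\<close>, there is an \<open>s\<close>
  with \<open>b / a = (d / c)\<^sup>s\<close>.  There is then a bijection \<open>f\<close> from \<open>G(a,b)\<close> to \<open>G(c,d)\<close>, not a homomorphism,
  that maps the coset \<open>V z\<^sup>n\<close> to \<open>V z\<^sup>s\<^sup>n\<close> by a diagonal matrix, is the identity on \<open>V\<close>, and maps the
  conjugate of \<open>z\<^sup>n\<close> by \<open>v\<close> to the conjugate of \<open>z\<^sup>s\<^sup>n\<close> by \<open>v\<close>.  By the description above, \<open>f\<close> induces a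
  bijection of fibered pairs that maps orbits to orbits.

  This suffices (\<open>fibered_Burnside_ring_iso\<close>): counting points of double cosets turns the
  multiplication formula into
  \<open>|K||L| [K, \<phi>] [L, \<psi>] = |Stab (L, \<psi>)| \<Sum> |K \<inter> L'| [K \<inter> L', \<phi> \<psi>']\<close>, where \<open>(L', \<psi>')\<close> runs through the orbit
  of \<open>(L, \<psi>)\<close> (\<open>fib_orbit_mult_scaled\<close>).  The right-hand side involves only orbits, intersections and
  cardinalities, and the factor \<open>|K||L|\<close> can be cancelled in a free abelian group.
\<close>

section \<open>Counting with double cosets and orbits\<close>

lemma sum_frag_cmul: "(\<Sum>s\<in>S. frag_cmul (h s) u) = frag_cmul (sum h S) u"
  by (induction S rule: infinite_finite_induct) (auto simp: frag_cmul_distrib)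

lemma sum_const_frag: "(\<Sum>s\<in>S. u) = frag_cmul (int (card S)) u"
  using sum_frag_cmul[of "\<lambda>_. 1" u S] by simp

context group
begin

lemma double_coset_eq:
  assumes K: "subgroup K G" and L: "subgroup L G" and s: "s \<in> carrier G"
    and t: "t \<in> (K #> s) <#> L"
  shows "t \<in> carrier G" and "(K #> t) <#> L = (K #> s) <#> L"
proof -
  note sub = subgroup.subset[OF K] subgroup.subset[OF L]
  note mem = double_coset_mem[OF sub]
  obtain k l where kl: "k \<in> K" "l \<in> L" "t = k \<otimes> s \<otimes> l"
    using t unfolding mem[OF s] by blast
  then have c: "k \<in> carrier G" "l \<in> carrier G" using sub by auto
  show tc: "t \<in> carrier G" using kl c s by simp
  have "u \<in> (K #> s) <#> L" if u0: "u \<in> (K #> t) <#> L" for u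
  proof -
    obtain k' l' where u: "k' \<in> K" "l' \<in> L" "u = k' \<otimes> t \<otimes> l'"
      using u0 unfolding mem[OF tc] by blast
    then have "k' \<in> carrier G" "l' \<in> carrier G" using sub by auto
    then have "u = (k' \<otimes> k) \<otimes> s \<otimes> (l \<otimes> l')"
      using u kl c s by (simp add: m_assoc)
    moreover have "k' \<otimes> k \<in> K" "l \<otimes> l' \<in> L"
      using K L kl u by (auto intro: subgroup.m_closed)
    ultimately show ?thesis unfolding mem[OF s] by blast
  qed
  moreover have "u \<in> (K #> t) <#> L" if u0: "u \<in> (K #> s) <#> L" for u
  proof -
    obtain k' l' where u: "k' \<in> K" "l' \<in> L" "u = k' \<otimes> s \<otimes> l'"
      using u0 unfolding mem[OF s] by blast
    then have "k' \<in> carrier G" "l' \<in> carrier G" using sub by auto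
    then have "u = (k' \<otimes> inv k) \<otimes> t \<otimes> (inv l \<otimes> l')"
      using u kl c s by (simp add: m_assoc group_cancel)
    moreover have "k' \<otimes> inv k \<in> K" "inv l \<otimes> l' \<in> L"
      using K L kl u by (auto intro: subgroup.m_closed subgroup.m_inv_closed)
    ultimately show ?thesis unfolding mem[OF tc] by blast
  qed
  ultimately show "(K #> t) <#> L = (K #> s) <#> L" by blast
qed

lemma self_mem_double_coset:
  assumes K: "subgroup K G" and L: "subgroup L G" and s: "s \<in> carrier G"
  shows "s \<in> (K #> s) <#> L"
proof -
  have "s = \<one> \<otimes> s \<otimes> \<one>" using s by simp
  then show ?thesis
    using s subgroup.subset[OF K] subgroup.subset[OF L] subgroup.one_closed[OF K]
      subgroup.one_closed[OF L] by (subst double_coset_mem) blast+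
qed

lemma sum_double_cosets:
  assumes "finite (carrier G)" and K: "subgroup K G" and L: "subgroup L G"
  shows "(\<Sum>s\<in>carrier G. h s) = (\<Sum>D\<in>double_cosets G K L. \<Sum>t\<in>D. h t)"
proof -
  have fibre: "{t \<in> carrier G. (K #> t) <#> L = D} = D" if D: "D \<in> double_cosets G K L" for D
  proof -
    obtain s where s: "s \<in> carrier G" "D = (K #> s) <#> L"
      using D unfolding double_cosets_def by blast
    show ?thesis
      using double_coset_eq[OF K L s(1)] self_mem_double_coset[OF K L] unfolding s(2) by blast
  qed
  have "(\<Sum>s\<in>carrier G. h s) =
      (\<Sum>D\<in>double_cosets G K L. \<Sum>t\<in>{t \<in> carrier G. (K #> t) <#> L = D}. h t)"
    unfolding double_cosets_def by (rule sum.image_gen[OF assms(1)])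
  also have "\<dots> = (\<Sum>D\<in>double_cosets G K L. \<Sum>t\<in>D. h t)"
    by (rule sum.cong) (simp_all only: fibre)
  finally show ?thesis .
qed

text \<open>
  Both sides count pairs in \<open>K \<times> L\<close>: the fibre of \<open>(k, l) \<mapsto> k s l\<close> over a point \<open>t\<close> of the double
  coset is in bijection with \<open>K \<inter> t L t\<inverse>\<close>.
\<close>

lemma sum_card_inter_conj_double_coset:
  assumes fin: "finite (carrier G)" and K: "subgroup K G" and L: "subgroup L G"
    and s: "s \<in> carrier G"
  shows "(\<Sum>t\<in>(K #> s) <#> L. card (K \<inter> conj_set G t L)) = card K * card L"
proof -
  note sub = subgroup.subset[OF K] subgroup.subset[OF L]
  have finKL: "finite (K \<times> L)" using sub fin by (auto intro: finite_subset)
  let ?f = "\<lambda>(k, l). k \<otimes> s \<otimes> l"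
  have D: "(K #> s) <#> L = ?f ` (K \<times> L)"
    using double_coset_mem[OF sub s] by (auto simp: image_iff)
  have fibre: "card {u \<in> K \<times> L. ?f u = t} = card (K \<inter> conj_set G t L)"
    if t: "t \<in> (K #> s) <#> L" for t
  proof -
    obtain k0 l0 where kl: "k0 \<in> K" "l0 \<in> L" "t = k0 \<otimes> s \<otimes> l0"
      using t unfolding double_coset_mem[OF sub s] by blast
    then have c: "k0 \<in> carrier G" "l0 \<in> carrier G" "t \<in> carrier G" using sub s by auto
    have "bij_betw (\<lambda>(k, l). k0 \<otimes> inv k) {u \<in> K \<times> L. ?f u = t} (K \<inter> conj_set G t L)"
    proof (rule bij_betw_byWitness[where f' = "\<lambda>m. (inv m \<otimes> k0, l0 \<otimes> inv t \<otimes> m \<otimes> t)"])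
      have 1: "(inv (k0 \<otimes> inv k) \<otimes> k0, l0 \<otimes> inv t \<otimes> (k0 \<otimes> inv k) \<otimes> t) = (k, l)"
        and 2: "k0 \<otimes> inv k \<in> K \<inter> conj_set G t L"
        if kl': "k \<in> K" "l \<in> L" "k \<otimes> s \<otimes> l = t" for k l
      proof -
        have c': "k \<in> carrier G" "l \<in> carrier G" using kl' sub by auto
        have "inv t \<otimes> (k0 \<otimes> inv k) \<otimes> t = inv (k0 \<otimes> s \<otimes> l0) \<otimes> (k0 \<otimes> inv k) \<otimes> (k \<otimes> s \<otimes> l)"
          by (simp only: kl(3)[symmetric] kl'(3))
        also have "\<dots> = inv l0 \<otimes> l"
          using c c' s by (simp add: inv_mult_group m_assoc group_cancel)
        finally have e: "inv t \<otimes> (k0 \<otimes> inv k) \<otimes> t = inv l0 \<otimes> l" .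
        then have "l0 \<otimes> (inv t \<otimes> (k0 \<otimes> inv k) \<otimes> t) = l"
          using c c' by (simp add: group_cancel)
        then show "(inv (k0 \<otimes> inv k) \<otimes> k0, l0 \<otimes> inv t \<otimes> (k0 \<otimes> inv k) \<otimes> t) = (k, l)"
          using c c' by (simp add: inv_mult_group m_assoc)
        have "inv l0 \<otimes> l \<in> L" "k0 \<otimes> inv k \<in> K"
          using kl kl' K L by (auto intro: subgroup.m_closed subgroup.m_inv_closed)
        then show "k0 \<otimes> inv k \<in> K \<inter> conj_set G t L"
          using e c c' by (simp add: conj_set_iff[OF c(3) sub(2)])
      qed
      show "\<forall>u\<in>{u \<in> K \<times> L. ?f u = t}. (\<lambda>m. (inv m \<otimes> k0, l0 \<otimes> inv t \<otimes> m \<otimes> t))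
          ((\<lambda>(k, l). k0 \<otimes> inv k) u) = u"
      proof
        fix u assume "u \<in> {u \<in> K \<times> L. ?f u = t}"
        then obtain k l where "u = (k, l)" "k \<in> K" "l \<in> L" "k \<otimes> s \<otimes> l = t" by auto
        then show "(\<lambda>m. (inv m \<otimes> k0, l0 \<otimes> inv t \<otimes> m \<otimes> t)) ((\<lambda>(k, l). k0 \<otimes> inv k) u) = u"
          by (simp only: prod.case 1)
      qed
      show "(\<lambda>(k, l). k0 \<otimes> inv k) ` {u \<in> K \<times> L. ?f u = t} \<subseteq> K \<inter> conj_set G t L"
      proof (rule image_subsetI)
        fix u assume "u \<in> {u \<in> K \<times> L. ?f u = t}"
        then obtain k l where "u = (k, l)" "k \<in> K" "l \<in> L" "k \<otimes> s \<otimes> l = t" by auto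
        then show "(\<lambda>(k, l). k0 \<otimes> inv k) u \<in> K \<inter> conj_set G t L"
          using 2[of k l] by (simp only: prod.case)
      qed
      show "\<forall>m\<in>K \<inter> conj_set G t L.
          (\<lambda>(k, l). k0 \<otimes> inv k) (inv m \<otimes> k0, l0 \<otimes> inv t \<otimes> m \<otimes> t) = m"
      proof
        fix m assume "m \<in> K \<inter> conj_set G t L"
        then have "m \<in> carrier G" using sub by blast
        then show "(\<lambda>(k, l). k0 \<otimes> inv k) (inv m \<otimes> k0, l0 \<otimes> inv t \<otimes> m \<otimes> t) = m"
          using c by (simp add: inv_mult_group m_assoc group_cancel)
      qed
      show "(\<lambda>m. (inv m \<otimes> k0, l0 \<otimes> inv t \<otimes> m \<otimes> t)) ` (K \<inter> conj_set G t L)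
          \<subseteq> {u \<in> K \<times> L. ?f u = t}"
      proof
        fix u assume "u \<in> (\<lambda>m. (inv m \<otimes> k0, l0 \<otimes> inv t \<otimes> m \<otimes> t)) ` (K \<inter> conj_set G t L)"
        then obtain m where m: "m \<in> K" "m \<in> conj_set G t L"
          and u: "u = (inv m \<otimes> k0, l0 \<otimes> inv t \<otimes> m \<otimes> t)" by auto
        have mc: "m \<in> carrier G" using m sub by auto
        have ml: "inv t \<otimes> m \<otimes> t \<in> L" using m(2) c sub by (simp add: conj_set_iff)
        have "l0 \<otimes> (inv t \<otimes> m \<otimes> t) \<in> L" using ml kl L by (auto intro: subgroup.m_closed)
        then have 1: "l0 \<otimes> inv t \<otimes> m \<otimes> t \<in> L" using c mc by (simp add: m_assoc)
        have 2: "inv m \<otimes> k0 \<in> K"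
          using kl m K by (auto intro: subgroup.m_closed subgroup.m_inv_closed)
        have "inv m \<otimes> k0 \<otimes> s \<otimes> (l0 \<otimes> inv t \<otimes> m \<otimes> t) = inv m \<otimes> (k0 \<otimes> s \<otimes> l0) \<otimes> inv t \<otimes> m \<otimes> t"
          using c mc s by (simp add: m_assoc)
        also have "\<dots> = t" unfolding kl(3)[symmetric] using c mc by (simp add: m_assoc group_cancel)
        finally show "u \<in> {u \<in> K \<times> L. ?f u = t}" using 1 2 u by simp
      qed
    qed
    then show ?thesis by (rule bij_betw_same_card)
  qed
  have "card (K \<times> L) = (\<Sum>t\<in>(K #> s) <#> L. card {u \<in> K \<times> L. ?f u = t})"
    using sum.image_gen[OF finKL, of "\<lambda>_. 1::nat" ?f] unfolding D by simp
  also have "\<dots> = (\<Sum>t\<in>(K #> s) <#> L. card (K \<inter> conj_set G t L))"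
    by (rule sum.cong) (simp_all only: fibre)
  finally show ?thesis by (simp add: card_cartesian_product)
qed

lemma fib_meet_closed:
  assumes A: "comm_group A" and x: "x \<in> fib_pairs G A" and y: "y \<in> fib_pairs G A"
  shows "fib_meet A x y \<in> fib_pairs G A"
proof -
  interpret A: comm_group A by fact
  obtain K \<phi> L \<psi> where xy: "x = (K, \<phi>)" "y = (L, \<psi>)" by (cases x, cases y)
  have K: "subgroup K G" "\<phi> \<in> hom (G\<lparr>carrier := K\<rparr>) A"
    and L: "subgroup L G" "\<psi> \<in> hom (G\<lparr>carrier := L\<rparr>) A"
    using x y xy by (auto simp: fib_pairs_def)
  have "(\<lambda>z\<in>K \<inter> L. \<phi> z \<otimes>\<^bsub>A\<^esub> \<psi> z) \<in> hom (G\<lparr>carrier := K \<inter> L\<rparr>) A"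
    using K L by (auto simp: hom_def A.m_ac subgroup.m_closed Pi_iff)
  then show ?thesis
    using subgroups_Inter_pair[OF K(1) L(1)] by (simp add: xy fib_meet_def fib_pairs_def)
qed

text \<open>
  The fibres of the orbit map \<open>s \<mapsto> \<^sup>sy\<close> are the cosets of the stabilizer.  The stabilizer is written
  with \<open>\<^sup>1y\<close> in place of \<open>y\<close>, because conjugation makes the function in \<open>y\<close> undefined outside the
  subgroup; for fibered pairs the two agree.
\<close>

lemma card_fib_conj_fibre:
  assumes y: "fst y \<subseteq> carrier G" and z: "z \<in> fib_orbit G y"
  shows "card {s \<in> carrier G. fib_conj G s y = z} =
    card {s \<in> carrier G. fib_conj G s y = fib_conj G \<one> y}"
proof -
  obtain g where g: "g \<in> carrier G" "z = fib_conj G g y" using z by (auto simp: orbit_def)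
  have "bij_betw (\<lambda>s. inv g \<otimes> s) {s \<in> carrier G. fib_conj G s y = z}
      {s \<in> carrier G. fib_conj G s y = fib_conj G \<one> y}"
  proof (rule bij_betw_byWitness[where f' = "\<lambda>s. g \<otimes> s"])
    show "(\<lambda>s. inv g \<otimes> s) ` {s \<in> carrier G. fib_conj G s y = z}
        \<subseteq> {s \<in> carrier G. fib_conj G s y = fib_conj G \<one> y}"
      using g y by (auto simp flip: fib_conj_mult[of "inv g"]) (simp add: fib_conj_mult)
    show "(\<lambda>s. g \<otimes> s) ` {s \<in> carrier G. fib_conj G s y = fib_conj G \<one> y}
        \<subseteq> {s \<in> carrier G. fib_conj G s y = z}"
      using g y by (auto simp flip: fib_conj_mult[of g]) (simp add: fib_conj_mult)
  qed (use g in \<open>auto simp: group_cancel\<close>)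
  then show ?thesis by (rule bij_betw_same_card)
qed

lemma card_stabilizer_times_orbit:
  assumes fin: "finite (carrier G)" and y: "fst y \<subseteq> carrier G"
  shows "card {s \<in> carrier G. fib_conj G s y = fib_conj G \<one> y} * card (fib_orbit G y)
    = card (carrier G)"
proof -
  have im: "(\<lambda>s. fib_conj G s y) ` carrier G = fib_orbit G y" by (auto simp: orbit_def)
  have "card (carrier G) = (\<Sum>z\<in>fib_orbit G y. card {s \<in> carrier G. fib_conj G s y = z})"
    using sum.image_gen[OF fin, of "\<lambda>_. 1::nat" "\<lambda>s. fib_conj G s y"] by (simp add: im)
  then show ?thesis using card_fib_conj_fibre[OF y] by simp
qed

lemma sum_fib_conj:
  assumes fin: "finite (carrier G)" and y: "fst y \<subseteq> carrier G"
  shows "(\<Sum>s\<in>carrier G. h (fib_conj G s y)) =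
    frag_cmul (int (card {s \<in> carrier G. fib_conj G s y = fib_conj G \<one> y}))
      (\<Sum>z\<in>fib_orbit G y. h z)"
proof -
  have im: "(\<lambda>s. fib_conj G s y) ` carrier G = fib_orbit G y" by (auto simp: orbit_def)
  have "(\<Sum>s\<in>carrier G. h (fib_conj G s y)) =
      (\<Sum>z\<in>fib_orbit G y. \<Sum>s\<in>{s \<in> carrier G. fib_conj G s y = z}. h (fib_conj G s y))"
    using sum.image_gen[OF fin, of "\<lambda>s. h (fib_conj G s y)" "\<lambda>s. fib_conj G s y"] by (simp add: im)
  also have "\<dots> = (\<Sum>z\<in>fib_orbit G y. \<Sum>s\<in>{s \<in> carrier G. fib_conj G s y = z}. h z)"
    by (intro sum.cong) auto
  also have "\<dots> = (\<Sum>z\<in>fib_orbit G y.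
      frag_cmul (int (card {s \<in> carrier G. fib_conj G s y = fib_conj G \<one> y})) (h z))"
    using card_fib_conj_fibre[OF y]
    by (intro sum.cong refl) (simp add: sum_const_frag)
  finally show ?thesis by (simp add: frag_cmul_sum)
qed

text \<open>
  The multiplication formula without double cosets: weighting \<open>s\<close> by \<open>|K \<inter> \<^sup>sL|\<close>, the sum over a
  double coset becomes \<open>|K||L|\<close> times its term, and the sum over \<open>G\<close> becomes one over the orbit
  of \<open>y\<close>.
\<close>

theorem fib_orbit_mult_scaled:
  assumes fin: "finite (carrier G)" and A: "comm_group A"
    and x: "x \<in> fib_pairs G A" and y: "y \<in> fib_pairs G A"
  shows "frag_cmul (int (card (fst x) * card (fst y)))
      (fib_orbit_mult G A (fib_orbit G x) (fib_orbit G y)) =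
    frag_cmul (int (card {s \<in> carrier G. fib_conj G s y = fib_conj G \<one> y}))
      (\<Sum>z\<in>fib_orbit G y. frag_cmul (int (card (fst x \<inter> fst z)))
         (frag_of (fib_orbit G (fib_meet A x z))))"
proof -
  define K L where "K = fst x" and "L = fst y"
  have K: "subgroup K G" and L: "subgroup L G"
    using x y by (auto simp: K_def L_def fib_pairs_def)
  note sub = subgroup.subset[OF K] subgroup.subset[OF L]
  let ?t = "\<lambda>s. frag_of (fib_orbit G (fib_meet A x (fib_conj G s y)))"
  define r where "r D = (SOME s. s \<in> D)" for D :: "'a set"
  have r: "r D \<in> D" if "D \<in> double_cosets G K L" for D
    using that self_mem_double_coset[OF K L] unfolding r_def double_cosets_def
    by (metis (mono_tags, lifting) imageE someI)
  have fst_conj: "fst (fib_conj G s y) = conj_set G s L" for s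
    by (simp add: fib_conj_def L_def split: prod.splits)
  have "(\<Sum>s\<in>carrier G. frag_cmul (int (card (K \<inter> conj_set G s L))) (?t s)) =
      (\<Sum>D\<in>double_cosets G K L. \<Sum>s\<in>D. frag_cmul (int (card (K \<inter> conj_set G s L))) (?t s))"
    by (rule sum_double_cosets[OF fin K L])
  also have "\<dots> = (\<Sum>D\<in>double_cosets G K L. frag_cmul (int (card K * card L)) (?t (r D)))"
  proof (rule sum.cong[OF refl])
    fix D assume D: "D \<in> double_cosets G K L"
    then obtain s where s: "s \<in> carrier G" "D = (K #> s) <#> L"
      by (auto simp: double_cosets_def)
    have "?t t = ?t (r D)" if "t \<in> D" for t
      using fib_meet_double_coset[OF A x y s(1)] that r[OF D] s(2)
      unfolding K_def L_def by simp
    then have "(\<Sum>s\<in>D. frag_cmul (int (card (K \<inter> conj_set G s L))) (?t s)) =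
        (\<Sum>s\<in>D. frag_cmul (int (card (K \<inter> conj_set G s L))) (?t (r D)))"
      by (simp cong: sum.cong)
    also have "\<dots> = frag_cmul (\<Sum>s\<in>D. int (card (K \<inter> conj_set G s L))) (?t (r D))"
      by (rule sum_frag_cmul)
    also have "(\<Sum>s\<in>D. int (card (K \<inter> conj_set G s L))) = int (card K * card L)"
      using sum_card_inter_conj_double_coset[OF fin K L s(1)] s(2)
      by (metis (mono_tags, lifting) of_nat_sum sum.cong)
    finally show "(\<Sum>s\<in>D. frag_cmul (int (card (K \<inter> conj_set G s L))) (?t s)) =
        frag_cmul (int (card K * card L)) (?t (r D))" .
  qed
  also have "\<dots> = frag_cmul (int (card K * card L)) (\<Sum>D\<in>double_cosets G K L. ?t (r D))"
    by (simp only: frag_cmul_sum)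
  also have "(\<Sum>D\<in>double_cosets G K L. ?t (r D)) =
      fib_orbit_mult G A (fib_orbit G x) (fib_orbit G y)"
    using fib_orbit_mult_eq[OF A x y, of r] r by (simp add: K_def L_def)
  finally have "frag_cmul (int (card K * card L))
      (fib_orbit_mult G A (fib_orbit G x) (fib_orbit G y)) =
      (\<Sum>s\<in>carrier G. frag_cmul (int (card (K \<inter> fst (fib_conj G s y)))) (?t s))"
    by (simp add: fst_conj)
  then show ?thesis
    unfolding K_def L_def
    using sum_fib_conj[OF fin, of y "\<lambda>z. frag_cmul (int (card (fst x \<inter> fst z)))
         (frag_of (fib_orbit G (fib_meet A x z)))"] fib_pairs_subset[OF y]
    by simp
qed

end

section \<open>Isomorphisms of fibered Burnside rings from bijections of groups\<close>

text \<open>The pair \<open>(f(K), \<phi> \<circ> f\<inverse>)\<close>, for a map \<open>f\<close> that is injective on \<open>C\<close> and \<open>K \<subseteq> C\<close>.\<close>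

definition fib_transport :: "('g \<Rightarrow> 'h) \<Rightarrow> 'g set \<Rightarrow> 'g set \<times> ('g \<Rightarrow> 'a) \<Rightarrow> 'h set \<times> ('h \<Rightarrow> 'a)"
  where "fib_transport f C = (\<lambda>(K, \<phi>). (f ` K, \<lambda>y\<in>f ` K. \<phi> (the_inv_into C f y)))"

lemma fst_fib_transport [simp]: "fst (fib_transport f C x) = f ` fst x"
  by (simp add: fib_transport_def split: prod.splits)

lemma fib_transport_eqI:
  assumes "inj_on f C" and "K \<subseteq> C" and "\<psi> \<in> extensional (f ` K)"
    and "\<And>k. k \<in> K \<Longrightarrow> \<psi> (f k) = \<phi> k"
  shows "fib_transport f C (K, \<phi>) = (f ` K, \<psi>)"
  using assms
  by (auto simp: fib_transport_def fun_eq_iff extensional_def subset_iff the_inv_into_f_f)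

lemma inj_on_fib_transport:
  assumes f: "inj_on f (carrier G)"
  shows "inj_on (fib_transport f (carrier G)) (fib_pairs G A)"
proof (rule inj_onI)
  fix x y assume x: "x \<in> fib_pairs G A" and y: "y \<in> fib_pairs G A"
    and eq: "fib_transport f (carrier G) x = fib_transport f (carrier G) y"
  obtain K \<phi> L \<psi> where xy: "x = (K, \<phi>)" "y = (L, \<psi>)" by (cases x, cases y)
  have K: "K \<subseteq> carrier G" "\<phi> \<in> extensional K" and L: "L \<subseteq> carrier G" "\<psi> \<in> extensional L"
    using x y xy by (auto simp: fib_pairs_def dest: subgroup.subset)
  have KL: "K = L"
    using eq inj_on_image_eq_iff[OF f K(1) L(1)] by (simp add: xy fib_transport_def)
  have "\<phi> k = \<psi> k" if "k \<in> K" for k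
  proof -
    have "snd (fib_transport f (carrier G) x) (f k) = snd (fib_transport f (carrier G) y) (f k)"
      by (simp add: eq)
    moreover have "the_inv_into (carrier G) f (f k) = k"
      using that K(1) f by (intro the_inv_into_f_f) auto
    ultimately show ?thesis using that KL by (simp add: xy fib_transport_def)
  qed
  then show "x = y" using K L KL xy by (auto intro: extensionalityI)
qed

lemma fib_transport_meet:
  assumes f: "inj_on f C" and x: "fst x \<subseteq> C" and y: "fst y \<subseteq> C"
  shows "fib_transport f C (fib_meet A x y) = fib_meet A (fib_transport f C x) (fib_transport f C y)"
proof -
  obtain K \<phi> L \<psi> where xy: "x = (K, \<phi>)" "y = (L, \<psi>)" by (cases x, cases y)
  have im: "f ` (K \<inter> L) = f ` K \<inter> f ` L"
    using inj_on_image_Int[OF f] x y xy by simp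
  have "fib_transport f C (K \<inter> L, \<lambda>z\<in>K \<inter> L. \<phi> z \<otimes>\<^bsub>A\<^esub> \<psi> z) = (f ` (K \<inter> L),
      \<lambda>z\<in>f ` K \<inter> f ` L. (\<lambda>z\<in>f ` K. \<phi> (the_inv_into C f z)) z \<otimes>\<^bsub>A\<^esub>
        (\<lambda>z\<in>f ` L. \<psi> (the_inv_into C f z)) z)"
    using f x xy by (intro fib_transport_eqI) (auto simp: im the_inv_into_f_f subset_iff)
  then show ?thesis by (simp add: xy fib_transport_def fib_meet_def im)
qed

lemma frag_cmul_cancel:
  assumes "frag_cmul k u = frag_cmul k v" "k \<noteq> 0"
  shows "u = v"
proof -
  have "frag_cmul k (u - v) = 0"
    using assms(1) by (metis add_diff_cancel diff_add_cancel diff_self frag_cmul_distrib2)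
  then show ?thesis using assms(2) by simp
qed

text \<open>A bilinear extension is determined on the basis.\<close>

lemma frag_extend_bilinear_cong:
  assumes "Poly_Mapping.keys u \<subseteq> S" "Poly_Mapping.keys v \<subseteq> S"
    and m: "\<And>X Y. \<lbrakk>X \<in> S; Y \<in> S\<rbrakk> \<Longrightarrow> frag_extend (\<lambda>Z. frag_of (h Z)) (m X Y) = n (h X) (h Y)"
  defines "\<Phi> \<equiv> frag_extend (\<lambda>Z. frag_of (h Z))"
  shows "\<Phi> (frag_extend (\<lambda>X. frag_extend (\<lambda>Y. m X Y) v) u) =
    frag_extend (\<lambda>X. frag_extend (\<lambda>Y. n X Y) (\<Phi> v)) (\<Phi> u)"
  using assms(1)
proof (induction u rule: frag_induction)
  case (one X)
  have "\<Phi> (frag_extend (\<lambda>Y. m X Y) v) = frag_extend (\<lambda>Y. n (h X) Y) (\<Phi> v)"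
    using assms(2)
    by (induction v rule: frag_induction)
      (use one m in \<open>simp_all add: \<Phi>_def frag_extend_diff\<close>)
  then show ?case by (simp add: \<Phi>_def)
qed (simp_all add: \<Phi>_def frag_extend_diff)

lemma frag_extend_relabel_inverse:
  assumes "Poly_Mapping.keys u \<subseteq> S" and "\<And>X. X \<in> S \<Longrightarrow> g (h X) = X"
  shows "frag_extend (\<lambda>Y. frag_of (g Y)) (frag_extend (\<lambda>X. frag_of (h X)) u) = u"
  using assms(1)
  by (induction u rule: frag_induction) (simp_all add: assms(2) frag_extend_diff)

text \<open>
  The scaled multiplication formula involves only the orbits, the cardinalities of intersections
  and the meets of pairs, and all of these are preserved by \<open>f\<close>.  The map \<open>f\<close> need not be a
  homomorphism.
\<close>

theorem fibered_Burnside_ring_iso: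
  fixes G :: "('g, 'x) monoid_scheme" and H :: "('h, 'z) monoid_scheme"
    and A :: "('a, 'y) monoid_scheme" and f :: "'g \<Rightarrow> 'h"
  assumes "group G" and "group H" and fin: "finite (carrier G)" and A: "comm_group A"
    and f: "bij_betw f (carrier G) (carrier H)"
    and pairs: "fib_transport f (carrier G) ` fib_pairs G A = fib_pairs H A"
    and orb: "\<And>x. x \<in> fib_pairs G A \<Longrightarrow>
      fib_transport f (carrier G) ` fib_orbit G x = fib_orbit H (fib_transport f (carrier G) x)"
  shows "fibered_Burnside_ring A G \<simeq> fibered_Burnside_ring A H"
proof -
  interpret G: group G by fact
  interpret H: group H by fact
  interpret A: comm_group A by fact
  define F :: "'g set \<times> ('g \<Rightarrow> 'a) \<Rightarrow> 'h set \<times> ('h \<Rightarrow> 'a)"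
    where "F = fib_transport f (carrier G)"
  define h where "h = (`) F"
  define \<Phi> where "\<Phi> = frag_extend (\<lambda>X. frag_of (h X))"
  have inj: "inj_on f (carrier G)" and im: "f ` carrier G = carrier H"
    using f by (auto simp: bij_betw_def)
  have injF: "inj_on F (fib_pairs G A)"
    unfolding F_def by (rule inj_on_fib_transport[OF inj])
  have finH: "finite (carrier H)" and cardH: "card (carrier H) = card (carrier G)"
    using f fin bij_betw_finite bij_betw_same_card by metis+
  have F_pairs: "F x \<in> fib_pairs H A" if "x \<in> fib_pairs G A" for x
    using pairs that by (auto simp: F_def)
  have orbF: "h (fib_orbit G x) = fib_orbit H (F x)" if "x \<in> fib_pairs G A" for x
    using orb that by (simp add: h_def F_def)
  have orbit_sub: "fib_orbit G x \<subseteq> fib_pairs G A" if "x \<in> fib_pairs G A" for x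
    using G.fib_conj_pairs[OF A that] by (auto simp: orbit_def)
  have card_img: "card (f ` K) = card K" if "K \<subseteq> carrier G" for K
    using inj_on_subset[OF inj that] by (rule card_image)

  have h_img: "h ` fib_orbits G A = fib_orbits H A"
  proof -
    have "h ` fib_orbits G A = (\<lambda>x. fib_orbit H (F x)) ` fib_pairs G A"
      using orbF by (auto simp: orbits_def image_iff)
    also have "\<dots> = fib_orbits H A"
      unfolding orbits_def pairs[symmetric] F_def by blast
    finally show ?thesis .
  qed
  have h_inj: "inj_on h (fib_orbits G A)"
  proof (rule inj_onI)
    fix X Y assume "X \<in> fib_orbits G A" "Y \<in> fib_orbits G A" "h X = h Y"
    then show "X = Y"
      using inj_on_image_eq_iff[OF injF, of X Y] orbit_sub by (auto simp: orbits_def h_def)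
  qed

  have mult: "\<Phi> (fib_orbit_mult G A X Y) = fib_orbit_mult H A (h X) (h Y)"
    if XY: "X \<in> fib_orbits G A" "Y \<in> fib_orbits G A" for X Y
  proof -
    obtain x y where x: "x \<in> fib_pairs G A" "X = fib_orbit G x"
      and y: "y \<in> fib_pairs G A" "Y = fib_orbit G y"
      using XY unfolding orbits_def by blast
    note sub = G.fib_pairs_subset[OF x(1)] G.fib_pairs_subset[OF y(1)]
    define c where "c = card {s \<in> carrier G. fib_conj G s y = fib_conj G \<one>\<^bsub>G\<^esub> y}"
    define c' where "c' = card {s \<in> carrier H. fib_conj H s (F y) = fib_conj H \<one>\<^bsub>H\<^esub> (F y)}"
    have cc: "c = c'"
    proof -
      have "c * card (fib_orbit G y) = card (carrier G)"
        unfolding c_def by (rule G.card_stabilizer_times_orbit[OF fin sub(2)])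
      moreover have "c' * card (fib_orbit H (F y)) = card (carrier H)"
        unfolding c'_def
        by (rule H.card_stabilizer_times_orbit[OF finH H.fib_pairs_subset[OF F_pairs[OF y(1)]]])
      moreover have "card (fib_orbit H (F y)) = card (fib_orbit G y)"
        using orbF[OF y(1)] card_image[OF inj_on_subset[OF injF orbit_sub[OF y(1)]]]
        by (simp add: h_def)
      moreover have "card (carrier G) \<noteq> 0" using fin by auto
      ultimately show ?thesis using cardH by (metis mult_eq_0_iff mult_right_cancel)
    qed
    have meet_term: "\<Phi> (frag_of (fib_orbit G (fib_meet A x z))) =
          frag_of (fib_orbit H (fib_meet A (F x) (F z)))"
        "card (fst (F x) \<inter> fst (F z)) = card (fst x \<inter> fst z)"
      if "z \<in> fib_orbit G y" for z
    proof -
      have z: "z \<in> fib_pairs G A" using orbit_sub[OF y(1)] that by blast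
      note zsub = G.fib_pairs_subset[OF z]
      have "\<Phi> (frag_of (fib_orbit G (fib_meet A x z))) = frag_of (fib_orbit H (F (fib_meet A x z)))"
        by (simp add: \<Phi>_def orbF[OF G.fib_meet_closed[OF A x(1) z]])
      also have "F (fib_meet A x z) = fib_meet A (F x) (F z)"
        unfolding F_def by (rule fib_transport_meet[OF inj sub(1) zsub])
      finally show "\<Phi> (frag_of (fib_orbit G (fib_meet A x z))) =
          frag_of (fib_orbit H (fib_meet A (F x) (F z)))" .
      have "fst (F x) \<inter> fst (F z) = f ` (fst x \<inter> fst z)"
        using inj_on_image_Int[OF inj sub(1) zsub] by (simp add: F_def)
      then show "card (fst (F x) \<inter> fst (F z)) = card (fst x \<inter> fst z)"
        using card_img[of "fst x \<inter> fst z"] sub by auto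
    qed
    have finO: "finite (fib_orbit G y)"
      using fin by (simp add: orbit_def)
    define k where "k = int (card (fst x) * card (fst y))"
    have "frag_cmul k (\<Phi> (fib_orbit_mult G A X Y)) =
        frag_cmul (int c) (\<Sum>z\<in>fib_orbit G y. frag_cmul (int (card (fst x \<inter> fst z)))
           (\<Phi> (frag_of (fib_orbit G (fib_meet A x z)))))"
      unfolding \<Phi>_def frag_extend_cmul[symmetric] k_def x(2) y(2) c_def
        G.fib_orbit_mult_scaled[OF fin A x(1) y(1)]
      using finO by (simp add: frag_extend_cmul frag_extend_sum o_def)
    also have "\<dots> = frag_cmul (int c') (\<Sum>z\<in>fib_orbit G y. frag_cmul (int (card (fst (F x) \<inter> fst (F z))))
           (frag_of (fib_orbit H (fib_meet A (F x) (F z)))))"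
      unfolding cc by (intro arg_cong[where f = "frag_cmul (int c')"] sum.cong refl) (simp only: meet_term)
    also have "\<dots> = frag_cmul (int c') (\<Sum>z\<in>fib_orbit H (F y). frag_cmul (int (card (fst (F x) \<inter> fst z)))
           (frag_of (fib_orbit H (fib_meet A (F x) z))))"
      unfolding orbF[OF y(1), symmetric] h_def
      by (subst sum.reindex[OF inj_on_subset[OF injF orbit_sub[OF y(1)]]]) (simp add: o_def)
    also have "\<dots> = frag_cmul (int (card (fst (F x)) * card (fst (F y))))
        (fib_orbit_mult H A (fib_orbit H (F x)) (fib_orbit H (F y)))"
      unfolding c'_def
      by (rule H.fib_orbit_mult_scaled[OF finH A F_pairs[OF x(1)] F_pairs[OF y(1)], symmetric])
    also have "int (card (fst (F x)) * card (fst (F y))) = k"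
      using card_img sub by (simp add: k_def F_def)
    finally have "frag_cmul k (\<Phi> (fib_orbit_mult G A X Y)) =
        frag_cmul k (fib_orbit_mult H A (h X) (h Y))"
      by (simp add: x y orbF)
    moreover have "k \<noteq> 0"
    proof -
      have "finite (fst x)" "finite (fst y)" using sub fin finite_subset by auto
      moreover have "\<one>\<^bsub>G\<^esub> \<in> fst x" "\<one>\<^bsub>G\<^esub> \<in> fst y"
        using x(1) y(1) by (auto simp: fib_pairs_def subgroup.one_closed)
      ultimately show ?thesis by (auto simp: k_def card_eq_0_iff)
    qed
    ultimately show ?thesis by (rule frag_cmul_cancel)
  qed

  have one: "\<Phi> (frag_of (fib_orbit G (carrier G, \<lambda>x\<in>carrier G. \<one>\<^bsub>A\<^esub>))) =
      frag_of (fib_orbit H (carrier H, \<lambda>x\<in>carrier H. \<one>\<^bsub>A\<^esub>))"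
  proof -
    have "(carrier G, \<lambda>x\<in>carrier G. \<one>\<^bsub>A\<^esub>) \<in> fib_pairs G A"
      using G.subgroup_self by (auto simp: fib_pairs_def hom_def)
    moreover have "F (carrier G, \<lambda>x\<in>carrier G. \<one>\<^bsub>A\<^esub>) = (carrier H, \<lambda>x\<in>carrier H. \<one>\<^bsub>A\<^esub>)"
      unfolding F_def im[symmetric] by (rule fib_transport_eqI[OF inj]) auto
    ultimately show ?thesis by (simp add: \<Phi>_def orbF)
  qed

  have key_closed: "Poly_Mapping.keys (\<Phi> u) \<subseteq> fib_orbits H A"
    if "Poly_Mapping.keys u \<subseteq> fib_orbits G A" for u
    using keys_frag_extend[of "\<lambda>X. frag_of (h X)" u] that h_img by (auto simp: \<Phi>_def)
  have bij: "bij_betw \<Phi> {u. Poly_Mapping.keys u \<subseteq> fib_orbits G A}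
      {u. Poly_Mapping.keys u \<subseteq> fib_orbits H A}"
  proof -
    define g where "g = the_inv_into (fib_orbits G A) h"
    have gh: "g (h X) = X" if "X \<in> fib_orbits G A" for X
      unfolding g_def by (rule the_inv_into_f_f[OF h_inj that])
    have hg: "h (g Y) = Y" if "Y \<in> fib_orbits H A" for Y
      unfolding g_def by (rule f_the_inv_into_f[OF h_inj]) (simp add: h_img that)
    have g_mem: "g Y \<in> fib_orbits G A" if "Y \<in> fib_orbits H A" for Y
      unfolding g_def by (rule the_inv_into_into[OF h_inj _ order_refl]) (simp add: h_img that)
    show ?thesis
    proof (rule bij_betw_byWitness[where f' = "frag_extend (\<lambda>Y. frag_of (g Y))"])
      show "frag_extend (\<lambda>Y. frag_of (g Y)) ` {u. Poly_Mapping.keys u \<subseteq> fib_orbits H A}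
          \<subseteq> {u. Poly_Mapping.keys u \<subseteq> fib_orbits G A}"
        using keys_frag_extend[of "\<lambda>Y. frag_of (g Y)"] g_mem by fastforce
    qed (use key_closed gh hg in \<open>auto simp: \<Phi>_def intro!: frag_extend_relabel_inverse\<close>)
  qed

  have "\<Phi> \<in> ring_iso (fibered_Burnside_ring A G) (fibered_Burnside_ring A H)"
  proof (rule ring_iso_memI)
    fix u v assume "u \<in> carrier (fibered_Burnside_ring A G)" "v \<in> carrier (fibered_Burnside_ring A G)"
    then show "\<Phi> (u \<otimes>\<^bsub>fibered_Burnside_ring A G\<^esub> v) = \<Phi> u \<otimes>\<^bsub>fibered_Burnside_ring A H\<^esub> \<Phi> v"
      using frag_extend_bilinear_cong[of u "fib_orbits G A" v h "fib_orbit_mult G A" "fib_orbit_mult H A"]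
        mult by (simp add: fibered_Burnside_ring_def \<Phi>_def)
    show "\<Phi> (u \<oplus>\<^bsub>fibered_Burnside_ring A G\<^esub> v) = \<Phi> u \<oplus>\<^bsub>fibered_Burnside_ring A H\<^esub> \<Phi> v"
      by (simp add: fibered_Burnside_ring_def \<Phi>_def frag_extend_add)
  qed (use key_closed one bij in
      \<open>simp_all add: fibered_Burnside_ring_def free_Abelian_group_def\<close>)
  then show ?thesis by (auto simp: is_ring_iso_def)
qed

section \<open>Subgroups of the plane over the prime field\<close>

text \<open>
  A subgroup of \<open>(\<int>/p)\<^sup>2\<close> is represented by its preimage in \<open>\<int>\<^sup>2\<close>, so that membership needs no
  reduction modulo \<open>p\<close>.
\<close>

definition plane_subgroup :: "nat \<Rightarrow> (int \<times> int) set \<Rightarrow> bool"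
  where "plane_subgroup p W \<longleftrightarrow>
    (\<forall>x y. (int p * x, int p * y) \<in> W) \<and>
    (\<forall>x y x' y'. (x, y) \<in> W \<longrightarrow> (x', y') \<in> W \<longrightarrow> (x + x', y + y') \<in> W) \<and>
    (\<forall>r x y. (x, y) \<in> W \<longrightarrow> (r * x, r * y) \<in> W)"

text \<open>
  A subgroup that is stable under all diagonal matrices.  For \<open>p\<close> prime these are \<open>0\<close>, the two
  coordinate axes and the whole plane.
\<close>

definition diagonal_subgroup :: "nat \<Rightarrow> (int \<times> int) set \<Rightarrow> bool"
  where "diagonal_subgroup p U \<longleftrightarrow> plane_subgroup p U \<and>
    (\<forall>r s x y. (x, y) \<in> U \<longrightarrow> (r * x, s * y) \<in> U)"

lemma plane_subgroupD:
  assumes "plane_subgroup p W"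
  shows "(int p * x, int p * y) \<in> W"
    and "(x, y) \<in> W \<Longrightarrow> (x', y') \<in> W \<Longrightarrow> (x + x', y + y') \<in> W"
    and "(x, y) \<in> W \<Longrightarrow> (r * x, r * y) \<in> W"
    and "(0, 0) \<in> W"
proof -
  show 1: "(int p * x, int p * y) \<in> W" for x y
    using assms unfolding plane_subgroup_def by blast
  show "(x, y) \<in> W \<Longrightarrow> (x', y') \<in> W \<Longrightarrow> (x + x', y + y') \<in> W"
    using assms unfolding plane_subgroup_def by blast
  show "(x, y) \<in> W \<Longrightarrow> (r * x, r * y) \<in> W"
    using assms unfolding plane_subgroup_def by blast
  show "(0, 0) \<in> W" using 1[of 0 0] by simp
qed

lemma plane_subgroup_cong:
  assumes W: "plane_subgroup p W" and "[x = x'] (mod int p)" "[y = y'] (mod int p)"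
  shows "(x, y) \<in> W \<longleftrightarrow> (x', y') \<in> W"
proof -
  have "(u', v') \<in> W" if uv: "(u, v) \<in> W" "[u = u'] (mod int p)" "[v = v'] (mod int p)" for u v u' v'
  proof -
    obtain k l where "u' = u + int p * k" "v' = v + int p * l"
      using uv(2,3) by (auto simp: cong_iff_lin)
    then show ?thesis
      using plane_subgroupD(2)[OF W uv(1) plane_subgroupD(1)[OF W, of k l]] by simp
  qed
  from this[of x y x' y'] this[of x' y' x y] show ?thesis using assms(2,3) cong_sym by blast
qed

lemma plane_subgroup_scale_iff:
  assumes W: "plane_subgroup p W" and r: "coprime r (int p)"
  shows "(r * x, r * y) \<in> W \<longleftrightarrow> (x, y) \<in> W"
proof
  assume rxy: "(r * x, r * y) \<in> W"
  obtain t where t: "[r * t = 1] (mod int p)" using cong_solve_coprime_int[OF r] by blast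
  have "[t * (r * u) = u] (mod int p)" for u
    using cong_scalar_right[OF t, of u] by (simp add: mult_ac)
  then show "(x, y) \<in> W"
    using plane_subgroupD(3)[OF W rxy, of t] plane_subgroup_cong[OF W] by blast
qed (use plane_subgroupD(3)[OF W] in blast)

lemma diagonal_subgroup_imp_plane: "diagonal_subgroup p U \<Longrightarrow> plane_subgroup p U"
  by (simp add: diagonal_subgroup_def)

lemma diagonal_subgroup_scale:
  "diagonal_subgroup p U \<Longrightarrow> (x, y) \<in> U \<Longrightarrow> (r * x, s * y) \<in> U"
  by (simp add: diagonal_subgroup_def)

lemma diagonal_subgroup_scale_iff:
  assumes U: "diagonal_subgroup p U" and r: "coprime r (int p)" and s: "coprime s (int p)"
  shows "(r * x, s * y) \<in> U \<longleftrightarrow> (x, y) \<in> U"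
proof
  assume "(r * x, s * y) \<in> U"
  from diagonal_subgroup_scale[OF U this, of s r]
  have "((r * s) * x, (r * s) * y) \<in> U" by (simp add: mult_ac)
  then show "(x, y) \<in> U"
    using plane_subgroup_scale_iff[OF diagonal_subgroup_imp_plane[OF U]] r s by simp
qed (use diagonal_subgroup_scale[OF U] in blast)


section \<open>Computing in \<open>G(a,b)\<close>\<close>

text \<open>
  The element \<open>(x mod p, y mod p) z\<^sup>n\<close> of \<open>G(a,b)\<close>.  With arbitrary integers \<open>x\<close>, \<open>y\<close> and an arbitrary
  natural number \<open>n\<close>, products need no reduction.
\<close>

definition elt :: "nat \<Rightarrow> nat \<Rightarrow> int \<Rightarrow> int \<Rightarrow> nat \<Rightarrow> (int \<times> int) \<times> int"
  where "elt p q x y n = ((x mod int p, y mod int p), int (n mod q))"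

lemma elt_eq_iff:
  "elt p q x y m = elt p q x' y' n \<longleftrightarrow>
     [x = x'] (mod int p) \<and> [y = y'] (mod int p) \<and> [m = n] (mod q)"
  by (auto simp: elt_def cong_def)

lemma snd_elt: "snd (elt p q x y n) = int (n mod q)"
  by (simp add: elt_def)

text \<open>The group \<open>G(a,b)\<close> for two different elements \<open>a\<close> and \<open>b\<close> of order \<open>q\<close>.\<close>

locale planar_semidirect =
  fixes p q :: nat and a b :: int
  assumes p: "prime p" and q: "prime q"
    and a: "a \<in> Units (residue_ring (int p))" "group.ord (units_of (residue_ring (int p))) a = q"
    and b: "b \<in> Units (residue_ring (int p))" "group.ord (units_of (residue_ring (int p))) b = q"
    and ab: "a \<noteq> b"
begin

abbreviation G where "G \<equiv> G_group p q a b"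

abbreviation el where "el \<equiv> elt p q"

sublocale G: group G
  by (rule group_G_group[OF p q a b])

sublocale R: residues "int p" "residue_ring (int p)"
  using prime_gt_1_nat[OF p] by unfold_locales auto

lemma p_pos: "0 < int p" and q_pos: "0 < q"
  using prime_gt_0_nat p q by auto

lemma coprime_p: "coprime r (int p) \<longleftrightarrow> \<not> [r = 0] (mod int p)"
  using p prime_imp_coprime[of "int p" r]
  by (auto simp: cong_0_iff coprime_commute prime_int_nat_transfer)

lemma unit_facts:
  assumes u: "u \<in> Units (residue_ring (int p))" "group.ord (units_of (residue_ring (int p))) u = q"
  shows "[u ^ n = 1] (mod int p) \<longleftrightarrow> q dvd n" and "coprime u (int p)" and "0 \<le> u" "u < int p"
proof -
  interpret U: group "units_of (residue_ring (int p))" by (rule R.units_group)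
  have uu: "0 < u" "u < int p" "coprime u (int p)" using u(1) R.res_units_eq by auto
  then show "coprime u (int p)" "0 \<le> u" "u < int p" by auto
  have "u [^]\<^bsub>residue_ring (int p)\<^esub> n = u ^ n mod int p"
    using R.pow_cong[of u n] uu by simp
  moreover have "u [^]\<^bsub>units_of (residue_ring (int p))\<^esub> n = \<one>\<^bsub>units_of (residue_ring (int p))\<^esub> \<longleftrightarrow> q dvd n"
    using U.pow_eq_id[of u n] u by (simp add: units_of_carrier)
  ultimately show "[u ^ n = 1] (mod int p) \<longleftrightarrow> q dvd n"
    using u(1) by (simp add: R.units_of_pow units_of_one R.one_cong cong_def)
qed

lemma power_cong:
  assumes u: "u \<in> Units (residue_ring (int p))" "group.ord (units_of (residue_ring (int p))) u = q"
    and mn: "[m = n] (mod q)"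
  shows "[u ^ m = u ^ n] (mod int p)"
proof -
  have *: "[u ^ k = u ^ (k mod q)] (mod int p)" for k
  proof -
    have "[u ^ (q * (k div q)) * u ^ (k mod q) = 1 * u ^ (k mod q)] (mod int p)"
      using unit_facts(1)[OF u] by (intro cong_mult) auto
    then show ?thesis by (simp flip: power_add)
  qed
  show ?thesis using *[of m] *[of n] mn by (metis cong_def)
qed

lemma a_powers: "[a ^ n = 1] (mod int p) \<longleftrightarrow> q dvd n" "coprime (a ^ n) (int p)"
    "[a ^ (n mod q) = a ^ n] (mod int p)"
  using unit_facts(1,2)[OF a] power_cong[OF a, of "n mod q" n] by auto

lemma b_powers: "[b ^ n = 1] (mod int p) \<longleftrightarrow> q dvd n" "coprime (b ^ n) (int p)"
    "[b ^ (n mod q) = b ^ n] (mod int p)"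
  using unit_facts(1,2)[OF b] power_cong[OF b, of "n mod q" n] by auto

lemma carrier_G: "carrier G = {((x, y), i). 0 \<le> x \<and> x < int p \<and> 0 \<le> y \<and> y < int p \<and> 0 \<le> i \<and> i < int q}"
  using q_pos
  by (auto simp: G_group_def semidirect_product_def DirProd_def residue_ring_def integer_mod_group_def)

lemma elt_closed [simp]: "el x y n \<in> carrier G"
  using p_pos q_pos by (auto simp: elt_def carrier_G)

lemma carrier_elt:
  assumes "g \<in> carrier G"
  obtains x y n where "g = el x y n"
proof -
  obtain x y i where g: "g = ((x, y), i)" "0 \<le> x" "x < int p" "0 \<le> y" "y < int p" "0 \<le> i" "i < int q"
    using assms by (auto simp: carrier_G)
  then have "g = el x y (nat i)" by (simp add: elt_def flip: zmod_int)
  then show ?thesis by (rule that)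
qed

lemma set_eqI_elt:
  assumes "X \<subseteq> carrier G" "Y \<subseteq> carrier G"
    and "\<And>x y n. el x y n \<in> X \<longleftrightarrow> el x y n \<in> Y"
  shows "X = Y"
proof -
  have "g \<in> X \<longleftrightarrow> g \<in> Y" if "g \<in> carrier G" for g
    using that assms(3) by (auto elim!: carrier_elt)
  then show ?thesis using assms(1,2) by blast
qed

lemma finite_G: "finite (carrier G)"
  using order_G_group[OF p q, of a b] prime_gt_0_nat[OF p] prime_gt_0_nat[OF q]
  by (metis G.order_gt_0_iff_finite nat_0_less_mult_iff zero_less_power)

lemma one_elt: "\<one>\<^bsub>G\<^esub> = el 0 0 0"
  using q_pos
  by (simp add: G_group_def semidirect_product_def DirProd_def residue_ring_def
      integer_mod_group_def elt_def)

lemma mult_elt: "el x y m \<otimes>\<^bsub>G\<^esub> el x' y' n = el (x + a ^ m * x') (y + b ^ m * y') (m + n)"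
proof -
  have pow: "u [^]\<^bsub>residue_ring (int p)\<^esub> k = u ^ k mod int p"
    if "0 \<le> u" "u < int p" for u k
    using R.pow_cong[of u k] that by simp
  have act: "[w mod int p + (u ^ (m mod q) mod int p) * (w' mod int p) = w + u ^ m * w'] (mod int p)"
    if "[u ^ (m mod q) = u ^ m] (mod int p)" for u w w'
    using that by (intro cong_add cong_mult) (auto simp: cong_def)
  have "el x y m \<otimes>\<^bsub>G\<^esub> el x' y' n =
     (((x mod int p + (a ^ (m mod q) mod int p) * (x' mod int p)) mod int p,
       (y mod int p + (b ^ (m mod q) mod int p) * (y' mod int p)) mod int p), (int (m mod q) + int (n mod q)) mod int q)"
    using q_pos pow[OF unit_facts(3,4)[OF a]] pow[OF unit_facts(3,4)[OF b]]
    by (simp add: G_group_def semidirect_product_def DirProd_def elt_def integer_mod_group_def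
        G_action_def Let_def R.res_add_eq R.res_mult_eq mod_add_right_eq)
  also have "\<dots> = el (x + a ^ m * x') (y + b ^ m * y') (m + n)"
    using act[OF a_powers(3)[of m], of x x'] act[OF b_powers(3)[of m], of y y']
    by (simp add: elt_def cong_def mod_add_eq flip: of_nat_add zmod_int)
  finally show ?thesis .
qed

lemma inv_power:
  "[a ^ ((q - 1) * n) * a ^ n = 1] (mod int p)" "[b ^ ((q - 1) * n) * b ^ n = 1] (mod int p)"
proof -
  have "(q - 1) * n + n = q * n" using q_pos by (cases q) simp_all
  then show "[a ^ ((q - 1) * n) * a ^ n = 1] (mod int p)" "[b ^ ((q - 1) * n) * b ^ n = 1] (mod int p)"
    by (simp_all add: a_powers b_powers flip: power_add)
qed

lemma inv_elt:
  "inv\<^bsub>G\<^esub> (el x y n) = el (- (a ^ ((q - 1) * n) * x)) (- (b ^ ((q - 1) * n) * y)) ((q - 1) * n)"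
proof (rule G.inv_equality)
  have "(q - 1) * n + n = q * n" using q_pos by (cases q) simp_all
  then show "el (- (a ^ ((q - 1) * n) * x)) (- (b ^ ((q - 1) * n) * y)) ((q - 1) * n) \<otimes>\<^bsub>G\<^esub> el x y n = \<one>\<^bsub>G\<^esub>"
    by (simp add: mult_elt one_elt elt_eq_iff cong_0_iff)
qed simp_all

lemma conj_elt:
  "inv\<^bsub>G\<^esub> (el s t j) \<otimes>\<^bsub>G\<^esub> el x y n \<otimes>\<^bsub>G\<^esub> el s t j =
    el (a ^ ((q - 1) * j) * (x - s + a ^ n * s)) (b ^ ((q - 1) * j) * (y - t + b ^ n * t)) n"
proof -
  have "(q - 1) * j + n + j = q * j + n" using q_pos by (cases q) simp_all
  then have "[(q - 1) * j + n + j = n] (mod q)"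
    by (simp only: cong_def mod_mult_self4)
  then show ?thesis
    by (simp add: inv_elt mult_elt elt_eq_iff power_add algebra_simps)
qed

end

section \<open>The fibered pairs of \<open>G(a,b)\<close>\<close>

definition planar_set :: "nat \<Rightarrow> nat \<Rightarrow> (int \<times> int) set \<Rightarrow> ((int \<times> int) \<times> int) set"
  where "planar_set p q W = {elt p q x y 0 | x y. (x, y) \<in> W}"

text \<open>A subgroup \<open>W\<close> of \<open>P\<^sub>a \<oplus> P\<^sub>b\<close> with its trivial homomorphism.\<close>

definition planar_pair ::
    "nat \<Rightarrow> nat \<Rightarrow> ('c, 'm) monoid_scheme \<Rightarrow> (int \<times> int) set \<Rightarrow>
     ((int \<times> int) \<times> int) set \<times> ((int \<times> int) \<times> int \<Rightarrow> 'c)"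
  where "planar_pair p q A W = (planar_set p q W, \<lambda>g\<in>planar_set p q W. \<one>\<^bsub>A\<^esub>)"

text \<open>The conjugate of \<open>U Q\<close> by the vector \<open>(v, w)\<close>.\<close>

definition split_set ::
    "nat \<Rightarrow> nat \<Rightarrow> int \<Rightarrow> int \<Rightarrow> (int \<times> int) set \<Rightarrow> int \<Rightarrow> int \<Rightarrow> ((int \<times> int) \<times> int) set"
  where "split_set p q a b U v w =
    {elt p q x y n | x y n. (x - v + a ^ n * v, y - w + b ^ n * w) \<in> U}"

text \<open>
  That subgroup with the homomorphism that sends the conjugate of \<open>z\<close> to \<open>\<alpha>\<close> and has \<open>U\<close> in its
  kernel; it exists if \<open>U\<close> is stable under \<open>z\<close> and \<open>\<alpha>\<^sup>q = 1\<close>.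
\<close>

definition split_pair ::
    "nat \<Rightarrow> nat \<Rightarrow> int \<Rightarrow> int \<Rightarrow> ('c, 'm) monoid_scheme \<Rightarrow> (int \<times> int) set \<Rightarrow> 'c \<Rightarrow> int \<Rightarrow> int \<Rightarrow>
     ((int \<times> int) \<times> int) set \<times> ((int \<times> int) \<times> int \<Rightarrow> 'c)"
  where "split_pair p q a b A U \<alpha> v w =
    (split_set p q a b U v w, \<lambda>g\<in>split_set p q a b U v w. \<alpha> [^]\<^bsub>A\<^esub> nat (snd g))"

context planar_semidirect
begin

lemma elt_in_planar_set:
  assumes "plane_subgroup p W"
  shows "el x y n \<in> planar_set p q W \<longleftrightarrow> q dvd n \<and> (x, y) \<in> W"
proof
  assume "el x y n \<in> planar_set p q W"
  then obtain x' y' where "(x', y') \<in> W" "[x = x'] (mod int p)" "[y = y'] (mod int p)" "q dvd n"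
    by (auto simp: planar_set_def elt_eq_iff cong_0_iff)
  then show "q dvd n \<and> (x, y) \<in> W" using plane_subgroup_cong[OF assms] by blast
next
  assume *: "q dvd n \<and> (x, y) \<in> W"
  then have "el x y n = el x y 0" by (simp add: elt_eq_iff cong_0_iff)
  then show "el x y n \<in> planar_set p q W" using * unfolding planar_set_def by blast
qed

lemma elt_in_split_set:
  assumes U: "diagonal_subgroup p U"
  shows "el x y n \<in> split_set p q a b U v w \<longleftrightarrow> (x - v + a ^ n * v, y - w + b ^ n * w) \<in> U"
proof
  assume "el x y n \<in> split_set p q a b U v w"
  then obtain x' y' n' where e: "[x = x'] (mod int p)" "[y = y'] (mod int p)" "[n = n'] (mod q)"
    and U': "(x' - v + a ^ n' * v, y' - w + b ^ n' * w) \<in> U"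
    by (auto simp: split_set_def elt_eq_iff)
  have "[x - v + a ^ n * v = x' - v + a ^ n' * v] (mod int p)"
    "[y - w + b ^ n * w = y' - w + b ^ n' * w] (mod int p)"
    using e power_cong[OF a e(3)] power_cong[OF b e(3)]
    by (auto intro!: cong_add cong_diff cong_mult)
  then show "(x - v + a ^ n * v, y - w + b ^ n * w) \<in> U"
    using U' plane_subgroup_cong[OF diagonal_subgroup_imp_plane[OF U]] by blast
qed (auto simp: split_set_def)

lemma planar_set_subset: "planar_set p q W \<subseteq> carrier G"
  by (auto simp: planar_set_def)

lemma split_set_subset: "split_set p q a b U v w \<subseteq> carrier G"
  by (auto simp: split_set_def)

lemma subgroup_planar_set:
  assumes W: "plane_subgroup p W"
  shows "subgroup (planar_set p q W) G"
proof (rule G.subgroupI[OF planar_set_subset])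
  have "el 0 0 0 \<in> planar_set p q W" using plane_subgroupD(4)[OF W] by (auto simp: planar_set_def)
  then show "planar_set p q W \<noteq> {}" by blast
next
  fix g assume "g \<in> planar_set p q W"
  then obtain x y where "g = el x y 0" "(x, y) \<in> W" by (auto simp: planar_set_def)
  then show "inv\<^bsub>G\<^esub> g \<in> planar_set p q W"
    using plane_subgroupD(3)[OF W, of x y "- 1"] by (simp add: inv_elt elt_in_planar_set[OF W])
next
  fix g h assume "g \<in> planar_set p q W" "h \<in> planar_set p q W"
  then obtain x y x' y' where "g = el x y 0" "(x, y) \<in> W" "h = el x' y' 0" "(x', y') \<in> W"
    by (auto simp: planar_set_def)
  then show "g \<otimes>\<^bsub>G\<^esub> h \<in> planar_set p q W"
    using plane_subgroupD(2)[OF W, of x y x' y'] by (simp add: mult_elt elt_in_planar_set[OF W])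
qed

lemma subgroup_split_set:
  assumes U: "diagonal_subgroup p U"
  shows "subgroup (split_set p q a b U v w) G"
proof (rule G.subgroupI[OF split_set_subset])
  note P = diagonal_subgroup_imp_plane[OF U]
  have "el 0 0 0 \<in> split_set p q a b U v w"
    using plane_subgroupD(4)[OF P] by (simp add: elt_in_split_set[OF U])
  then show "split_set p q a b U v w \<noteq> {}" by blast
  fix g assume "g \<in> split_set p q a b U v w"
  then obtain x y m where g: "g = el x y m" and gU: "(x - v + a ^ m * v, y - w + b ^ m * w) \<in> U"
    by (auto simp: split_set_def)
  show "inv\<^bsub>G\<^esub> g \<in> split_set p q a b U v w"
  proof -
    let ?m = "(q - 1) * m"
    have *: "[- (u ^ ?m) * (z - t + u ^ m * t) = - (u ^ ?m * z) - t + u ^ ?m * t] (mod int p)"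
      if "[u ^ ?m * u ^ m = 1] (mod int p)" for u z t
    proof -
      have "[u ^ ?m * t - u ^ ?m * z - u ^ ?m * u ^ m * t = u ^ ?m * t - u ^ ?m * z - 1 * t] (mod int p)"
        by (intro cong_diff cong_mult that cong_refl)
      then show ?thesis by (simp add: algebra_simps)
    qed
    show ?thesis
      using diagonal_subgroup_scale[OF U gU, of "- (a ^ ?m)" "- (b ^ ?m)"]
        plane_subgroup_cong[OF P *[OF inv_power(1)] *[OF inv_power(2)]]
      by (simp add: g inv_elt elt_in_split_set[OF U])
  qed
  fix h assume "h \<in> split_set p q a b U v w"
  then obtain x' y' n where h: "h = el x' y' n" and hU: "(x' - v + a ^ n * v, y' - w + b ^ n * w) \<in> U"
    by (auto simp: split_set_def)
  show "g \<otimes>\<^bsub>G\<^esub> h \<in> split_set p q a b U v w"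
    using plane_subgroupD(2)[OF P gU diagonal_subgroup_scale[OF U hU, of "a ^ m" "b ^ m"]]
    by (simp add: g h mult_elt elt_in_split_set[OF U] power_add algebra_simps)
qed

text \<open>The set \<open>{(x, y). (b\<^sup>j x, a\<^sup>j y) \<in> W}\<close> is the image of \<open>W\<close> under \<open>z\<^sup>j\<close>.\<close>

lemma conj_planar_set:
  assumes W: "plane_subgroup p W"
  shows "plane_subgroup p {(x, y). (b ^ j * x, a ^ j * y) \<in> W}"
    and "conj_set G (el s t j) (planar_set p q W) = planar_set p q {(x, y). (b ^ j * x, a ^ j * y) \<in> W}"
proof -
  let ?W = "{(x, y). (b ^ j * x, a ^ j * y) \<in> W}"
  show P: "plane_subgroup p ?W"
    unfolding plane_subgroup_def
  proof (clarsimp, intro conjI allI impI)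
    fix x y show "(b ^ j * (int p * x), a ^ j * (int p * y)) \<in> W"
      using plane_subgroupD(1)[OF W, of "b ^ j * x" "a ^ j * y"] by (simp add: mult_ac)
  next
    fix x y x' y' assume "(b ^ j * x, a ^ j * y) \<in> W" "(b ^ j * x', a ^ j * y') \<in> W"
    from plane_subgroupD(2)[OF W this] show "(b ^ j * (x + x'), a ^ j * (y + y')) \<in> W"
      by (simp add: algebra_simps)
  next
    fix r x y assume "(b ^ j * x, a ^ j * y) \<in> W"
    from plane_subgroupD(3)[OF W this, of r] show "(b ^ j * (r * x), a ^ j * (r * y)) \<in> W"
      by (simp add: mult_ac)
  qed
  have "inv\<^bsub>G\<^esub> (el s t j) \<otimes>\<^bsub>G\<^esub> el x y n \<otimes>\<^bsub>G\<^esub> el s t j \<in> planar_set p q W \<longleftrightarrow> el x y n \<in> planar_set p q ?W"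
    for x y n
  proof (cases "q dvd n")
    case True
    let ?a = "a ^ ((q - 1) * j)" and ?b = "b ^ ((q - 1) * j)"
    \<comment> \<open>As \<open>W\<close> is stable under scalars, \<open>z\<^sup>-\<^sup>j\<close> may be replaced by \<open>(a b)\<^sup>j z\<^sup>-\<^sup>j\<close>, which is the diagonal
      matrix with entries \<open>b\<^sup>j\<close> and \<open>a\<^sup>j\<close>.\<close>
    have *: "[a ^ j * b ^ j * (u' * (k - l + c * l)) = u * k] (mod int p)"
      if "[c = 1] (mod int p)" "[u' * (a ^ j * b ^ j) = u] (mod int p)" for u u' c k l
    proof -
      have "[u' * (a ^ j * b ^ j) * (k - l + c * l) = u * (k - l + 1 * l)] (mod int p)"
        using that by (intro cong_mult cong_add) auto
      then show ?thesis by (simp add: mult_ac)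
    qed
    have ab: "[?a * (a ^ j * b ^ j) = b ^ j] (mod int p)" "[?b * (a ^ j * b ^ j) = a ^ j] (mod int p)"
      using cong_scalar_right[OF inv_power(1), of j "b ^ j"] cong_scalar_right[OF inv_power(2), of j "a ^ j"]
      by (simp_all add: mult_ac)
    have "(?a * (x - s + a ^ n * s), ?b * (y - t + b ^ n * t)) \<in> W \<longleftrightarrow>
        (a ^ j * b ^ j * (?a * (x - s + a ^ n * s)), a ^ j * b ^ j * (?b * (y - t + b ^ n * t))) \<in> W"
      using plane_subgroup_scale_iff[OF W, of "a ^ j * b ^ j"] a_powers(2) b_powers(2) by simp
    also have "\<dots> \<longleftrightarrow> (b ^ j * x, a ^ j * y) \<in> W"
      by (rule plane_subgroup_cong[OF W *[OF _ ab(1)] *[OF _ ab(2)]])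
        (simp_all add: a_powers b_powers True)
    finally show ?thesis by (simp add: conj_elt elt_in_planar_set[OF W] elt_in_planar_set[OF P] True)
  qed (simp add: conj_elt elt_in_planar_set[OF W] elt_in_planar_set[OF P])
  then show "conj_set G (el s t j) (planar_set p q W) = planar_set p q ?W"
    using planar_set_subset[of W] planar_set_subset[of ?W]
    by (auto simp: G.conj_set_iff elim!: carrier_elt)
qed

lemma conj_split_set:
  assumes U: "diagonal_subgroup p U"
  shows "conj_set G (el s t j) (split_set p q a b U v w) =
    split_set p q a b U (s + a ^ j * v) (t + b ^ j * w)"
proof -
  have "inv\<^bsub>G\<^esub> (el s t j) \<otimes>\<^bsub>G\<^esub> el x y n \<otimes>\<^bsub>G\<^esub> el s t j \<in> split_set p q a b U v w \<longleftrightarrow>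
      el x y n \<in> split_set p q a b U (s + a ^ j * v) (t + b ^ j * w)" for x y n
  proof -
    let ?a = "a ^ ((q - 1) * j)" and ?b = "b ^ ((q - 1) * j)"
    have *: "[u ^ j * (u' * (k - l + u ^ n * l) - m + u ^ n * m) =
        k - (l + u ^ j * m) + u ^ n * (l + u ^ j * m)] (mod int p)"
      if "[u' * u ^ j = 1] (mod int p)" for u u' k l m
    proof -
      have "[(u' * u ^ j) * (k - l + u ^ n * l) - u ^ j * m + u ^ j * u ^ n * m =
          1 * (k - l + u ^ n * l) - u ^ j * m + u ^ j * u ^ n * m] (mod int p)"
        by (intro cong_add cong_diff cong_mult that cong_refl)
      then show ?thesis by (simp add: algebra_simps)
    qed
    have "(?a * (x - s + a ^ n * s) - v + a ^ n * v, ?b * (y - t + b ^ n * t) - w + b ^ n * w) \<in> U \<longleftrightarrow>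
        (a ^ j * (?a * (x - s + a ^ n * s) - v + a ^ n * v), b ^ j * (?b * (y - t + b ^ n * t) - w + b ^ n * w)) \<in> U"
      using diagonal_subgroup_scale_iff[OF U] a_powers(2) b_powers(2) by simp
    also have "\<dots> \<longleftrightarrow> (x - (s + a ^ j * v) + a ^ n * (s + a ^ j * v), y - (t + b ^ j * w) + b ^ n * (t + b ^ j * w)) \<in> U"
      by (rule plane_subgroup_cong[OF diagonal_subgroup_imp_plane[OF U] *[OF inv_power(1)] *[OF inv_power(2)]])
    finally show ?thesis by (simp add: conj_elt elt_in_split_set[OF U])
  qed
  then show ?thesis
    using split_set_subset[of U v w] split_set_subset[of U "s + a ^ j * v" "t + b ^ j * w"]
    by (auto simp: G.conj_set_iff elim!: carrier_elt)
qed

lemma conj_planar_pair: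
  assumes W: "plane_subgroup p W"
  shows "fib_conj G (el s t j) (planar_pair p q A W) =
    planar_pair p q A {(x, y). (b ^ j * x, a ^ j * y) \<in> W}"
proof -
  have "inv\<^bsub>G\<^esub> (el s t j) \<otimes>\<^bsub>G\<^esub> g \<otimes>\<^bsub>G\<^esub> el s t j \<in> planar_set p q W"
    if "g \<in> conj_set G (el s t j) (planar_set p q W)" for g
    using that by (simp add: G.conj_set_iff planar_set_subset)
  then show ?thesis
    by (auto simp: planar_pair_def fib_conj_def conj_planar_set(2)[OF W] intro!: restrict_ext)
qed

lemma conj_split_pair:
  assumes U: "diagonal_subgroup p U"
  shows "fib_conj G (el s t j) (split_pair p q a b A U \<alpha> v w) =
    split_pair p q a b A U \<alpha> (s + a ^ j * v) (t + b ^ j * w)"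
proof -
  have 1: "inv\<^bsub>G\<^esub> (el s t j) \<otimes>\<^bsub>G\<^esub> g \<otimes>\<^bsub>G\<^esub> el s t j \<in> split_set p q a b U v w"
    if "g \<in> conj_set G (el s t j) (split_set p q a b U v w)" for g
    using that by (simp add: G.conj_set_iff split_set_subset)
  have "snd (inv\<^bsub>G\<^esub> (el s t j) \<otimes>\<^bsub>G\<^esub> g \<otimes>\<^bsub>G\<^esub> el s t j) = snd g" if "g \<in> carrier G" for g
    using that by (auto elim!: carrier_elt simp: conj_elt snd_elt)
  then have "snd (inv\<^bsub>G\<^esub> (el s t j) \<otimes>\<^bsub>G\<^esub> g \<otimes>\<^bsub>G\<^esub> el s t j) = snd g"
    if "g \<in> split_set p q a b U (s + a ^ j * v) (t + b ^ j * w)" for g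
    using that split_set_subset by blast
  then show ?thesis
    using 1 unfolding conj_split_set[OF U]
    by (simp add: split_pair_def fib_conj_def conj_split_set[OF U] cong: restrict_cong)
qed

lemma orbit_planar_pair:
  assumes W: "plane_subgroup p W"
  shows "fib_orbit G (planar_pair p q A W) =
    range (\<lambda>j. planar_pair p q A {(x, y). (b ^ j * x, a ^ j * y) \<in> W})"
proof -
  have "fib_conj G g (planar_pair p q A W) \<in>
      range (\<lambda>j. planar_pair p q A {(x, y). (b ^ j * x, a ^ j * y) \<in> W})" if "g \<in> carrier G" for g
  proof -
    obtain s t j where "g = el s t j" using \<open>g \<in> carrier G\<close> by (rule carrier_elt)
    then show ?thesis by (simp add: conj_planar_pair[OF W])
  qed
  moreover have "planar_pair p q A {(x, y). (b ^ j * x, a ^ j * y) \<in> W} \<in> fib_orbit G (planar_pair p q A W)" for j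
    unfolding conj_planar_pair[OF W, of 0 0 j, symmetric] orbit_def using elt_closed by blast
  ultimately show ?thesis unfolding orbit_def by auto
qed

text \<open>Here the orbit consists of the conjugates by all vectors \<open>(v', w')\<close>.\<close>

lemma orbit_split_pair:
  assumes U: "diagonal_subgroup p U"
  shows "fib_orbit G (split_pair p q a b A U \<alpha> v w) = range (case_prod (split_pair p q a b A U \<alpha>))"
proof -
  have "fib_conj G g (split_pair p q a b A U \<alpha> v w) \<in> range (case_prod (split_pair p q a b A U \<alpha>))"
    if "g \<in> carrier G" for g
  proof -
    obtain s t j where "g = el s t j" using \<open>g \<in> carrier G\<close> by (rule carrier_elt)
    then show ?thesis using conj_split_pair[OF U, of s t j A \<alpha> v w] by force
  qed
  moreover have "split_pair p q a b A U \<alpha> v' w' \<in> fib_orbit G (split_pair p q a b A U \<alpha> v w)" for v' w'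
  proof -
    have "split_pair p q a b A U \<alpha> v' w' = fib_conj G (el (v' - v) (w' - w) 0) (split_pair p q a b A U \<alpha> v w)"
      by (simp add: conj_split_pair[OF U])
    then show ?thesis unfolding orbit_def using elt_closed by blast
  qed
  ultimately show ?thesis unfolding orbit_def by auto
qed

end

context planar_semidirect
begin

lemma planar_pair_in_fib_pairs:
  assumes A: "comm_group A" and W: "plane_subgroup p W"
  shows "planar_pair p q A W \<in> fib_pairs G A"
proof -
  interpret A: comm_group A by fact
  show ?thesis
    using subgroup_planar_set[OF W] subgroup.m_closed[OF subgroup_planar_set[OF W]]
    by (simp add: planar_pair_def fib_pairs_def hom_def)
qed

lemma pow_mod_q:
  assumes A: "comm_group A" and \<alpha>: "\<alpha> \<in> carrier A" "\<alpha> [^]\<^bsub>A\<^esub> q = \<one>\<^bsub>A\<^esub>"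
  shows "\<alpha> [^]\<^bsub>A\<^esub> (n mod q) = \<alpha> [^]\<^bsub>A\<^esub> (n :: nat)"
proof -
  interpret A: comm_group A by fact
  have "\<alpha> [^]\<^bsub>A\<^esub> (q * (n div q) + n mod q) = \<alpha> [^]\<^bsub>A\<^esub> (n mod q)"
    using \<alpha> by (simp only: A.nat_pow_mult[symmetric] A.nat_pow_pow[symmetric]) simp
  then show ?thesis by simp
qed

lemma split_pair_in_fib_pairs:
  assumes A: "comm_group A" and U: "diagonal_subgroup p U"
    and \<alpha>: "\<alpha> \<in> carrier A" "\<alpha> [^]\<^bsub>A\<^esub> q = \<one>\<^bsub>A\<^esub>"
  shows "split_pair p q a b A U \<alpha> v w \<in> fib_pairs G A"
proof -
  interpret A: comm_group A by fact
  let ?K = "split_set p q a b U v w"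
  have "\<alpha> [^]\<^bsub>A\<^esub> nat (snd (g \<otimes>\<^bsub>G\<^esub> h)) = \<alpha> [^]\<^bsub>A\<^esub> nat (snd g) \<otimes>\<^bsub>A\<^esub> \<alpha> [^]\<^bsub>A\<^esub> nat (snd h)"
    if "g \<in> ?K" "h \<in> ?K" for g h
  proof -
    obtain x y m x' y' n where "g = el x y m" "h = el x' y' n"
      using \<open>g \<in> ?K\<close> \<open>h \<in> ?K\<close> unfolding split_set_def by blast
    then show ?thesis using \<alpha> by (simp add: mult_elt snd_elt pow_mod_q[OF A \<alpha>] A.nat_pow_mult)
  qed
  then show ?thesis
    using subgroup_split_set[OF U] subgroup.m_closed[OF subgroup_split_set[OF U]] \<alpha>
    by (simp add: split_pair_def fib_pairs_def hom_def)
qed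

lemma pow_planar_elt: "el x y 0 [^]\<^bsub>G\<^esub> (k :: nat) = el (int k * x) (int k * y) 0"
  by (induction k) (simp_all add: one_elt mult_elt algebra_simps)

lemma snd_pow_elt: "\<exists>x' y'. el x y n [^]\<^bsub>G\<^esub> (k :: nat) = el x' y' (k * n)"
proof (induction k)
  case (Suc k)
  then obtain x' y' where "el x y n [^]\<^bsub>G\<^esub> k = el x' y' (k * n)" by blast
  then have "el x y n [^]\<^bsub>G\<^esub> Suc k = el (x' + a ^ (k * n) * x) (y' + b ^ (k * n) * y) (Suc k * n)"
    by (simp add: mult_elt add.commute)
  then show ?case by blast
qed (use one_elt in auto)

lemma pow_conj_generator:
  "el (v - a * v) (w - b * w) 1 [^]\<^bsub>G\<^esub> (n :: nat) = el (v - a ^ n * v) (w - b ^ n * w) n"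
  by (induction n) (simp_all add: one_elt mult_elt algebra_simps)

text \<open>
  A subgroup that is not contained in \<open>P\<^sub>a \<oplus> P\<^sub>b\<close> contains an element \<open>(x, y) z\<close>, because \<open>q\<close> is prime,
  and this element is a conjugate of \<open>z\<close> because \<open>1 - a\<close> and \<open>1 - b\<close> are invertible.  Its intersection with
  \<open>P\<^sub>a \<oplus> P\<^sub>b\<close> is stable under \<open>z\<close>, hence under all diagonal matrices because \<open>a \<noteq> b\<close>.  The
  homomorphism is trivial on that intersection because its elements have order dividing \<open>p\<close>.
\<close>

theorem fib_pairs_cases:
  assumes A: "comm_group A" and tors: "\<forall>\<alpha>\<in>carrier A. \<alpha> [^]\<^bsub>A\<^esub> p = \<one>\<^bsub>A\<^esub> \<longrightarrow> \<alpha> = \<one>\<^bsub>A\<^esub>"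
    and x: "x \<in> fib_pairs G A"
  obtains (planar) W where "plane_subgroup p W" "x = planar_pair p q A W"
  | (split) U \<alpha> v w where "diagonal_subgroup p U" "\<alpha> \<in> carrier A" "\<alpha> [^]\<^bsub>A\<^esub> q = \<one>\<^bsub>A\<^esub>"
      "x = split_pair p q a b A U \<alpha> v w"
proof -
  interpret A: comm_group A by fact
  obtain K \<phi> where x': "x = (K, \<phi>)" and K: "subgroup K G"
    and \<phi>: "\<phi> \<in> hom (G\<lparr>carrier := K\<rparr>) A" "\<phi> \<in> extensional K"
    using x by (auto simp: fib_pairs_def)
  have \<phi>_mult: "\<phi> (g \<otimes>\<^bsub>G\<^esub> h) = \<phi> g \<otimes>\<^bsub>A\<^esub> \<phi> h" if "g \<in> K" "h \<in> K" for g h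
    using \<phi>(1) that by (auto simp: hom_def)
  have \<phi>_closed: "\<phi> g \<in> carrier A" if "g \<in> K" for g
    using \<phi>(1) that by (auto simp: hom_def)
  have sub: "K \<subseteq> carrier G" by (rule subgroup.subset[OF K])
  have one: "\<one>\<^bsub>G\<^esub> \<in> K" by (rule subgroup.one_closed[OF K])
  have \<phi>_one: "\<phi> \<one>\<^bsub>G\<^esub> = \<one>\<^bsub>A\<^esub>"
    using \<phi>_mult[OF one one] \<phi>_closed[OF one] by simp
  have pow: "g [^]\<^bsub>G\<^esub> k \<in> K \<and> \<phi> (g [^]\<^bsub>G\<^esub> k) = \<phi> g [^]\<^bsub>A\<^esub> k" if g: "g \<in> K" for g and k :: nat
    by (induction k) (auto simp: one \<phi>_one \<phi>_mult g intro: subgroup.m_closed[OF K])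

  define W where "W = {(x, y). el x y 0 \<in> K}"
  have W: "plane_subgroup p W"
    unfolding plane_subgroup_def
  proof (intro conjI allI impI)
    fix x y
    have "el (int p * x) (int p * y) 0 = \<one>\<^bsub>G\<^esub>" by (simp add: one_elt elt_eq_iff cong_0_iff)
    then show "(int p * x, int p * y) \<in> W" using one by (simp add: W_def)
  next
    fix x y x' y' assume "(x, y) \<in> W" "(x', y') \<in> W"
    then show "(x + x', y + y') \<in> W"
      using subgroup.m_closed[OF K, of "el x y 0" "el x' y' 0"] by (simp add: W_def mult_elt)
  next
    fix r x y assume "(x, y) \<in> W"
    then have "el x y 0 [^]\<^bsub>G\<^esub> nat (r mod int p) \<in> K" using pow by (simp add: W_def)
    moreover have "el x y 0 [^]\<^bsub>G\<^esub> nat (r mod int p) = el (r * x) (r * y) 0"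
      using p_pos by (auto simp: pow_planar_elt elt_eq_iff intro!: cong_mult)
    ultimately show "(r * x, r * y) \<in> W" by (simp add: W_def)
  qed
  have \<phi>_W: "\<phi> (el x y 0) = \<one>\<^bsub>A\<^esub>" if "(x, y) \<in> W" for x y
  proof -
    have g: "el x y 0 \<in> K" using that by (simp add: W_def)
    have "el x y 0 [^]\<^bsub>G\<^esub> p = \<one>\<^bsub>G\<^esub>"
      by (simp add: pow_planar_elt one_elt elt_eq_iff cong_0_iff)
    then have "\<phi> (el x y 0) [^]\<^bsub>A\<^esub> p = \<one>\<^bsub>A\<^esub>" using pow[OF g, of p] \<phi>_one by simp
    then show ?thesis using tors \<phi>_closed[OF g] by blast
  qed

  show thesis
  proof (cases "\<forall>x y n. el x y n \<in> K \<longrightarrow> q dvd n")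
    case True
    have "el x y n \<in> K \<longleftrightarrow> el x y n \<in> planar_set p q W" for x y n
    proof (cases "q dvd n")
      case dvd: True
      then have "el x y n = el x y 0" by (simp add: elt_eq_iff cong_0_iff)
      then show ?thesis using dvd by (simp add: elt_in_planar_set[OF W]) (simp add: W_def)
    next
      case False
      then have "el x y n \<notin> K" using True by blast
      with False show ?thesis by (simp add: elt_in_planar_set[OF W])
    qed
    then have KW: "K = planar_set p q W"
      by (intro set_eqI_elt sub planar_set_subset)
    have "\<phi> g = \<one>\<^bsub>A\<^esub>" if "g \<in> K" for g
      using that \<phi>_W unfolding KW planar_set_def by auto
    then have "x = planar_pair p q A W"
      using \<phi>(2) unfolding x' planar_pair_def KW[symmetric]
      by (auto intro!: extensionalityI[of _ K])
    with W show thesis by (rule planar)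
  next
    case False
    then obtain x0 y0 n0 where g0: "el x0 y0 n0 \<in> K" "\<not> q dvd n0" by blast
    then have "coprime n0 q" using prime_imp_coprime[OF q] by (simp add: coprime_commute)
    then obtain k where k: "[n0 * k = 1] (mod q)"
      using cong_solve_coprime_nat[of n0 q] by auto
    \<comment> \<open>A power of the given element lies in the coset of \<open>z\<close>.\<close>
    obtain x1 y1 where "el x0 y0 n0 [^]\<^bsub>G\<^esub> k = el x1 y1 (k * n0)"
      using snd_pow_elt by blast
    then have g1': "el x1 y1 1 \<in> K"
      using pow[OF g0(1), of k] k by (metis cong_refl elt_eq_iff mult.commute)
    \<comment> \<open>It is \<open>(v, w) z (v, w)\<inverse>\<close> for a solution of \<open>v - a v = x\<^sub>1\<close> and \<open>w - b w = y\<^sub>1\<close>.\<close>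
    have solve: "\<exists>t. [t - u * t = z] (mod int p)" if "\<not> [u ^ 1 = 1] (mod int p)" for u z
    proof -
      have "coprime (1 - u) (int p)"
        using that by (simp add: coprime_p cong_iff_dvd_diff dvd_diff_commute)
      then obtain i where "[(1 - u) * i = 1] (mod int p)" using cong_solve_coprime_int by blast
      from cong_scalar_right[OF this, of z] show ?thesis
        by (intro exI[of _ "i * z"]) (simp add: algebra_simps)
    qed
    have "\<not> q dvd 1" using q by (simp add: prime_nat_iff)
    then obtain v w where "[v - a * v = x1] (mod int p)" "[w - b * w = y1] (mod int p)"
      using solve[of a x1] solve[of b y1] a_powers(1)[of 1] b_powers(1)[of 1] by metis
    then have g1: "el (v - a * v) (w - b * w) 1 \<in> K"
      using g1' by (metis cong_refl elt_eq_iff)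
    define \<alpha> where "\<alpha> = \<phi> (el (v - a * v) (w - b * w) 1)"
    have \<alpha>: "\<alpha> \<in> carrier A" unfolding \<alpha>_def by (rule \<phi>_closed[OF g1])
    have gn: "el (v - a ^ n * v) (w - b ^ n * w) n \<in> K" "\<phi> (el (v - a ^ n * v) (w - b ^ n * w) n) = \<alpha> [^]\<^bsub>A\<^esub> n" for n
      using pow[OF g1, of n] unfolding pow_conj_generator \<alpha>_def by auto
    have \<alpha>q: "\<alpha> [^]\<^bsub>A\<^esub> q = \<one>\<^bsub>A\<^esub>"
    proof -
      have "[v - a ^ q * v = v - 1 * v] (mod int p)" "[w - b ^ q * w = w - 1 * w] (mod int p)"
        by (intro cong_diff cong_mult cong_refl; simp add: a_powers b_powers)+
      then have "el (v - a ^ q * v) (w - b ^ q * w) q = \<one>\<^bsub>G\<^esub>"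
        by (simp add: one_elt elt_eq_iff cong_0_iff)
      then show ?thesis using gn(2)[of q] \<phi>_one by simp
    qed
    have split_elt: "el x y n = el (x - v + a ^ n * v) (y - w + b ^ n * w) 0 \<otimes>\<^bsub>G\<^esub> el (v - a ^ n * v) (w - b ^ n * w) n" for x y n
      by (simp add: mult_elt)
    have mem: "el x y n \<in> K \<longleftrightarrow> (x - v + a ^ n * v, y - w + b ^ n * w) \<in> W" for x y n
    proof
      assume "el x y n \<in> K"
      then have "el x y n \<otimes>\<^bsub>G\<^esub> inv\<^bsub>G\<^esub> (el (v - a ^ n * v) (w - b ^ n * w) n) \<in> K"
        using gn(1) K by (blast intro: subgroup.m_closed subgroup.m_inv_closed)
      then show "(x - v + a ^ n * v, y - w + b ^ n * w) \<in> W"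
        by (simp add: split_elt[of x y n] G.m_assoc W_def)
    next
      assume "(x - v + a ^ n * v, y - w + b ^ n * w) \<in> W"
      then show "el x y n \<in> K"
        using subgroup.m_closed[OF K _ gn(1)] unfolding split_elt[of x y n] W_def by blast
    qed
    have diag: "diagonal_subgroup p W"
      unfolding diagonal_subgroup_def
    proof (intro conjI allI impI W)
      fix r s x y assume xy: "(x, y) \<in> W"
      have "el (v - a * v) (w - b * w) 1 \<otimes>\<^bsub>G\<^esub> el x y 0 \<in> K"
        using g1 xy K by (auto simp: W_def intro: subgroup.m_closed)
      then have "(a * x, b * y) \<in> W" by (simp add: mult_elt mem)
      \<comment> \<open>Subtracting \<open>b (x, y)\<close> isolates the first coordinate.\<close>
      from plane_subgroupD(2)[OF W this plane_subgroupD(3)[OF W xy, of "- b"]]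
      have "((a - b) * x, (a - b) * 0) \<in> W" by (simp add: algebra_simps)
      moreover have "coprime (a - b) (int p)"
        using ab cong_less_imp_eq_int[OF unit_facts(3,4)[OF a] unit_facts(3,4)[OF b]]
        by (auto simp: coprime_p cong_diff_iff_cong_0)
      ultimately have x0: "(x, 0) \<in> W" using plane_subgroup_scale_iff[OF W] by blast
      from plane_subgroupD(2)[OF W xy plane_subgroupD(3)[OF W x0, of "- 1"]]
      have y0: "(0, y) \<in> W" by simp
      from plane_subgroupD(2)[OF W plane_subgroupD(3)[OF W x0, of r] plane_subgroupD(3)[OF W y0, of s]]
      show "(r * x, s * y) \<in> W" by simp
    qed
    have "el x y n \<in> K \<longleftrightarrow> el x y n \<in> split_set p q a b W v w" for x y n
      by (simp add: mem elt_in_split_set[OF diag])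
    then have KW: "K = split_set p q a b W v w"
      by (intro set_eqI_elt sub split_set_subset)
    have "\<phi> g = \<alpha> [^]\<^bsub>A\<^esub> nat (snd g)" if g: "g \<in> K" for g
    proof -
      obtain x y n where g': "g = el x y n" using subsetD[OF sub g] by (rule carrier_elt)
      then have xy: "(x - v + a ^ n * v, y - w + b ^ n * w) \<in> W" using g mem by simp
      then have "\<phi> g = \<phi> (el (x - v + a ^ n * v) (y - w + b ^ n * w) 0) \<otimes>\<^bsub>A\<^esub> \<alpha> [^]\<^bsub>A\<^esub> n"
        unfolding g' split_elt[of x y n] using gn by (subst \<phi>_mult) (auto simp: W_def)
      then show ?thesis using \<alpha> by (simp add: \<phi>_W[OF xy] g' snd_elt pow_mod_q[OF A \<alpha> \<alpha>q])
    qed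
    then have "x = split_pair p q a b A W \<alpha> v w"
      using \<phi>(2) unfolding x' split_pair_def KW[symmetric]
      by (auto intro!: extensionalityI[of _ K])
    with diag \<alpha> \<alpha>q show thesis by (rule split)
  qed
qed

end

section \<open>Comparing \<open>G(a,b)\<close> and \<open>G(c,d)\<close>\<close>

context planar_semidirect
begin

lemma a_power_cong_b_power: "[a ^ n = b ^ n] (mod int p) \<longleftrightarrow> q dvd n"
proof
  assume eq: "[a ^ n = b ^ n] (mod int p)"
  show "q dvd n"
  proof (rule ccontr)
    assume "\<not> q dvd n"
    then have "coprime n q" using prime_imp_coprime[OF q] by (simp add: coprime_commute)
    then obtain k where k: "[n * k = 1] (mod q)" using cong_solve_coprime_nat[of n q] by auto
    have "[a ^ 1 = a ^ (n * k)] (mod int p)" "[b ^ (n * k) = b ^ 1] (mod int p)"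
      using power_cong[OF a] power_cong[OF b] k cong_sym by blast+
    moreover have "[a ^ (n * k) = b ^ (n * k)] (mod int p)"
      unfolding power_mult using eq by (rule cong_pow)
    ultimately have "[a = b] (mod int p)" by (metis cong_trans power_one_right)
    then show False
      using ab cong_less_imp_eq_int[OF unit_facts(3,4)[OF a] unit_facts(3,4)[OF b]] by blast
  qed
next
  assume "q dvd n"
  then have "[a ^ n = 1] (mod int p)" "[b ^ n = 1] (mod int p)"
    using a_powers(1) b_powers(1) by auto
  then show "[a ^ n = b ^ n] (mod int p)" using cong_sym cong_trans by blast
qed

text \<open>The quotient \<open>b / a\<close>; its powers are all \<open>q\<close>-th roots of unity modulo \<open>p\<close>.\<close>

definition ratio :: int where "ratio = b * a ^ (q - 1)"

lemma ratio_power: "[ratio ^ n * a ^ n = b ^ n] (mod int p)"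
proof -
  have "[b ^ n * (a ^ ((q - 1) * n) * a ^ n) = b ^ n * 1] (mod int p)"
    by (intro cong_mult cong_refl inv_power)
  then show ?thesis by (simp add: ratio_def power_mult_distrib mult_ac flip: power_mult)
qed

lemma ratio_power_eq_1: "[ratio ^ n = 1] (mod int p) \<longleftrightarrow> q dvd n"
proof -
  have "[ratio ^ n = 1] (mod int p) \<longleftrightarrow> [ratio ^ n * a ^ n = 1 * a ^ n] (mod int p)"
    using cong_mult_rcancel a_powers(2) by blast
  also have "\<dots> \<longleftrightarrow> [a ^ n = b ^ n] (mod int p)"
    using ratio_power[of n] by (auto intro: cong_trans cong_sym)
  finally show ?thesis by (simp add: a_power_cong_b_power)
qed

lemma root_of_unity_ratio_power:
  assumes "[x ^ q = 1] (mod int p)"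
  obtains n where "[x = ratio ^ n] (mod int p)"
proof -
  interpret F: field "residue_ring (int p)"
    using residues_prime.is_field[OF residues_prime.intro[OF p]] .
  let ?roots = "{y \<in> carrier (residue_ring (int p)). y [^]\<^bsub>residue_ring (int p)\<^esub> q = \<one>\<^bsub>residue_ring (int p)\<^esub>}"
  have root: "y mod int p \<in> ?roots" if "[y ^ q = 1] (mod int p)" for y
    using that by (simp add: R.pow_cong R.one_cong cong_def)
  let ?pow = "\<lambda>n. ratio ^ n mod int p"
  have "coprime ratio (int p)"
    using unit_facts(2)[OF a] unit_facts(2)[OF b] by (simp add: ratio_def)
  have "inj_on ?pow {..<q}"
  proof (rule linorder_inj_onI')
    fix m n assume mn: "m \<in> {..<q}" "n \<in> {..<q}" "m < n"
    show "?pow m \<noteq> ?pow n"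
    proof
      assume "?pow m = ?pow n"
      then have "[ratio ^ m * ratio ^ (n - m) = ratio ^ m * 1] (mod int p)"
        using mn(3) by (simp add: cong_def flip: power_add)
      then have "[ratio ^ (n - m) = 1] (mod int p)"
        using cong_mult_lcancel \<open>coprime ratio (int p)\<close> coprime_power_left_iff by blast
      then show False using mn by (auto simp: ratio_power_eq_1 dest: dvd_imp_le)
    qed
  qed
  then have "card (?pow ` {..<q}) = q" by (simp add: card_image)
  moreover have "?pow ` {..<q} \<subseteq> ?roots"
    by (intro image_subsetI root) (simp add: ratio_power_eq_1 flip: power_mult)
  moreover have "card ?roots \<le> q"
    using F.num_roots_le_deg[OF R.finite] q_pos by simp
  ultimately have "?pow ` {..<q} = ?roots"
    by (intro card_seteq) (auto intro: finite_subset[OF _ R.finite])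
  then obtain n where "x mod int p = ?pow n" using root[OF assms] by blast
  then show ?thesis using that by (auto simp: cong_def)
qed

end

lemma exists_cong_quotient:
  assumes p: "prime p" and eq: "[A = 1] (mod int p) \<longleftrightarrow> [C = 1] (mod int p)"
  shows "\<exists>r. coprime r (int p) \<and> [r * (1 - A) = 1 - C] (mod int p) \<and> ([A = 1] (mod int p) \<longrightarrow> r = 1)"
proof (cases "[A = 1] (mod int p)")
  case True
  then have "[1 - A = 1 - C] (mod int p)"
    using eq by (meson cong_diff cong_refl cong_sym cong_trans)
  then show ?thesis by (intro exI[of _ 1]) simp
next
  case False
  have cop: "coprime (1 - z) (int p)" if "\<not> [z = 1] (mod int p)" for z
    using that prime_imp_coprime[of "int p" "1 - z"] p
    by (simp add: coprime_commute cong_iff_dvd_diff dvd_diff_commute prime_int_nat_transfer)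
  obtain i where i: "[(1 - A) * i = 1] (mod int p)"
    using cong_solve_coprime_int[OF cop[OF False]] by blast
  have "coprime ((1 - C) * i) (int p)"
    using cop[of C] False eq i by (metis coprime_iff_invertible_int coprime_mult_left_iff mult.commute)
  moreover have "[(1 - C) * i * (1 - A) = 1 - C] (mod int p)"
    using cong_scalar_left[OF i, of "1 - C"] by (simp add: mult_ac)
  ultimately show ?thesis using False by blast
qed

text \<open>
  The map \<open>f\<close> sends \<open>(x, y) z\<^sup>n\<close> to \<open>(r\<^sub>n x, r'\<^sub>n y) z\<^sup>s\<^sup>n\<close>.  The factors are chosen so that it sends
  \<open>(v, w) z\<^sup>n (v, w)\<inverse>\<close>, computed in \<open>G(a,b)\<close>, to \<open>(v, w) z\<^sup>s\<^sup>n (v, w)\<inverse>\<close>, computed in \<open>G(c,d)\<close>, and that it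
  is the identity on \<open>P\<^sub>a \<oplus> P\<^sub>b\<close>.  The exponent \<open>s\<close> is chosen so that \<open>(b / a)\<close> and \<open>(d / c)\<^sup>s\<close> agree, so
  \<open>z\<close> in the first group and \<open>z\<^sup>s\<close> in the second permute the lines in the same way.
\<close>

locale planar_semidirect_pair =
  I: planar_semidirect p q a b + J: planar_semidirect p q c d for p q a b c d +
  fixes s s' :: nat and r r' :: "nat \<Rightarrow> int"
  assumes s: "[s * s' = 1] (mod q)"
    and slopes: "[b * c ^ s = a * d ^ s] (mod int p)"
    and r: "coprime (r n) (int p)" "[r n * (1 - a ^ n) = 1 - c ^ (s * n)] (mod int p)"
      "q dvd n \<Longrightarrow> r n = 1"
    and r': "coprime (r' n) (int p)" "[r' n * (1 - b ^ n) = 1 - d ^ (s * n)] (mod int p)"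
      "q dvd n \<Longrightarrow> r' n = 1"
begin

definition f :: "(int \<times> int) \<times> int \<Rightarrow> (int \<times> int) \<times> int"
  where "f = (\<lambda>((x, y), i). elt p q (r (nat i) * x) (r' (nat i) * y) (s * nat i))"

lemma f_elt: "f (elt p q x y n) = elt p q (r (n mod q) * x) (r' (n mod q) * y) (s * n)"
proof -
  have "f (elt p q x y n) =
      elt p q (r (n mod q) * (x mod int p)) (r' (n mod q) * (y mod int p)) (s * (n mod q))"
    by (simp add: f_def elt_def)
  then show ?thesis by (simp add: elt_eq_iff cong_def mod_mult_right_eq)
qed

lemma s_cancel: "[s * m = s * n] (mod q) \<longleftrightarrow> [m = n] (mod q)"
proof -
  have "coprime s q" using s by (metis coprime_iff_invertible_nat One_nat_def)
  then show ?thesis by (rule cong_mult_lcancel_nat)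
qed

lemma carriers_eq: "carrier J.G = carrier I.G"
  by (simp add: I.carrier_G J.carrier_G)

lemma bij_f: "bij_betw f (carrier I.G) (carrier J.G)"
proof -
  have "inj_on f (carrier I.G)"
  proof (rule inj_onI)
    fix g h assume "g \<in> carrier I.G" "h \<in> carrier I.G" and eq: "f g = f h"
    then obtain x y m x' y' n where gh: "g = elt p q x y m" "h = elt p q x' y' n"
      by (metis I.carrier_elt)
    have mn: "[m = n] (mod q)" using eq by (simp add: gh f_elt elt_eq_iff s_cancel)
    then have "m mod q = n mod q" by (simp add: cong_def)
    then show "g = h"
      using eq mn r(1) r'(1) by (simp add: gh f_elt elt_eq_iff cong_mult_lcancel)
  qed
  moreover have "f ` carrier I.G \<subseteq> carrier I.G"
    by (auto elim!: I.carrier_elt simp: f_elt)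
  ultimately show ?thesis
    using endo_inj_surj[OF I.finite_G] by (simp add: bij_betw_def carriers_eq)
qed

lemma f_planar_set: "f ` planar_set p q W = planar_set p q W"
proof -
  have "f g = g" if "g \<in> planar_set p q W" for g
    using that r(3)[of 0] r'(3)[of 0] by (auto simp: planar_set_def f_elt)
  then show ?thesis by simp
qed

lemma f_split_set:
  assumes U: "diagonal_subgroup p U"
  shows "f ` split_set p q a b U v w = split_set p q c d U v w"
proof -
  have *: "[\<rho> * (z - t + u ^ n * t) = \<rho> * z - t + k ^ (s * n) * t] (mod int p)"
    if "[\<rho> * (1 - u ^ (n mod q)) = 1 - k ^ (s * (n mod q))] (mod int p)"
      "[u ^ (n mod q) = u ^ n] (mod int p)" "[k ^ (s * (n mod q)) = k ^ (s * n)] (mod int p)"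
    for \<rho> z t u k n
  proof -
    have "[\<rho> * (1 - u ^ n) = \<rho> * (1 - u ^ (n mod q))] (mod int p)"
      by (intro cong_mult cong_diff cong_refl cong_sym[OF that(2)])
    also note that(1)
    also have "[1 - k ^ (s * (n mod q)) = 1 - k ^ (s * n)] (mod int p)"
      by (intro cong_diff cong_refl that)
    finally have "[\<rho> * (1 - u ^ n) = 1 - k ^ (s * n)] (mod int p)" .
    then have "[\<rho> * z - \<rho> * (1 - u ^ n) * t = \<rho> * z - (1 - k ^ (s * n)) * t] (mod int p)"
      by (intro cong_diff cong_mult cong_refl)
    then show ?thesis by (simp add: algebra_simps)
  qed
  have sn: "[s * (n mod q) = s * n] (mod q)" for n
    by (simp add: cong_def mod_mult_right_eq)
  have mem: "f (elt p q x y n) \<in> split_set p q c d U v w \<longleftrightarrow> elt p q x y n \<in> split_set p q a b U v w"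
    for x y n
  proof -
    have "(r (n mod q) * (x - v + a ^ n * v), r' (n mod q) * (y - w + b ^ n * w)) \<in> U \<longleftrightarrow>
        (r (n mod q) * x - v + c ^ (s * n) * v, r' (n mod q) * y - w + d ^ (s * n) * w) \<in> U"
      by (intro plane_subgroup_cong[OF diagonal_subgroup_imp_plane[OF U]]
          *[OF r(2) I.a_powers(3) J.power_cong[OF J.a sn]]
          *[OF r'(2) I.b_powers(3) J.power_cong[OF J.b sn]])
    then show ?thesis
      by (simp add: f_elt I.elt_in_split_set[OF U] J.elt_in_split_set[OF U]
          diagonal_subgroup_scale_iff[OF U r(1) r'(1)])
  qed
  have "f g \<in> split_set p q c d U v w \<longleftrightarrow> g \<in> split_set p q a b U v w" if "g \<in> carrier I.G" for g
    using that mem by (auto elim!: I.carrier_elt)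
  moreover have "split_set p q c d U v w \<subseteq> f ` carrier I.G"
    using J.split_set_subset bij_f by (simp add: bij_betw_def)
  ultimately show ?thesis
    using I.split_set_subset[of U v w] by blast
qed

lemma transport_planar_pair:
  "fib_transport f (carrier I.G) (planar_pair p q A W) = planar_pair p q A W"
proof -
  have "fib_transport f (carrier I.G) (planar_pair p q A W) =
      (f ` planar_set p q W, \<lambda>g\<in>f ` planar_set p q W. \<one>\<^bsub>A\<^esub>)"
    unfolding planar_pair_def
    by (rule fib_transport_eqI[OF _ I.planar_set_subset]) (use bij_f in \<open>auto simp: bij_betw_def\<close>)
  then show ?thesis by (simp add: f_planar_set planar_pair_def)
qed

lemma transport_split_pair:
  assumes A: "comm_group A" and U: "diagonal_subgroup p U"
    and \<beta>: "\<beta> \<in> carrier A" "\<beta> [^]\<^bsub>A\<^esub> q = \<one>\<^bsub>A\<^esub>"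
  shows "fib_transport f (carrier I.G) (split_pair p q a b A U (\<beta> [^]\<^bsub>A\<^esub> s) v w) =
    split_pair p q c d A U \<beta> v w"
proof -
  interpret A: comm_group A by fact
  let ?K = "split_set p q a b U v w"
  have \<beta>s: "\<beta> [^]\<^bsub>A\<^esub> s \<in> carrier A" "(\<beta> [^]\<^bsub>A\<^esub> s) [^]\<^bsub>A\<^esub> q = \<one>\<^bsub>A\<^esub>"
    using \<beta> by (simp, metis A.nat_pow_one A.nat_pow_pow mult.commute)
  have "\<beta> [^]\<^bsub>A\<^esub> nat (snd (f g)) = (\<beta> [^]\<^bsub>A\<^esub> s) [^]\<^bsub>A\<^esub> nat (snd g)" if "g \<in> carrier I.G" for g
  proof -
    obtain x y n where "g = elt p q x y n" using \<open>g \<in> carrier I.G\<close> by (rule I.carrier_elt)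
    then show ?thesis
      using A.nat_pow_pow[OF \<beta>(1), of s n]
      by (simp add: f_elt snd_elt I.pow_mod_q[OF A \<beta>] I.pow_mod_q[OF A \<beta>s])
  qed
  then have powers: "\<beta> [^]\<^bsub>A\<^esub> nat (snd (f g)) = (\<beta> [^]\<^bsub>A\<^esub> s) [^]\<^bsub>A\<^esub> nat (snd g)" if "g \<in> ?K" for g
    using that I.split_set_subset by blast
  have "fib_transport f (carrier I.G) (split_pair p q a b A U (\<beta> [^]\<^bsub>A\<^esub> s) v w) =
      (f ` ?K, \<lambda>g\<in>f ` ?K. \<beta> [^]\<^bsub>A\<^esub> nat (snd g))"
    unfolding split_pair_def
  proof (rule fib_transport_eqI[OF _ I.split_set_subset])
    show "inj_on f (carrier I.G)" using bij_f by (simp add: bij_betw_def)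
  qed (simp_all add: powers)
  then show ?thesis by (simp add: f_split_set[OF U] split_pair_def)
qed

lemma pow_inverse_exponents:
  assumes A: "comm_group A" and \<alpha>: "\<alpha> \<in> carrier A" "\<alpha> [^]\<^bsub>A\<^esub> q = \<one>\<^bsub>A\<^esub>"
  shows "(\<alpha> [^]\<^bsub>A\<^esub> s') [^]\<^bsub>A\<^esub> s = \<alpha>" and "(\<alpha> [^]\<^bsub>A\<^esub> s') \<in> carrier A" and "(\<alpha> [^]\<^bsub>A\<^esub> s') [^]\<^bsub>A\<^esub> q = \<one>\<^bsub>A\<^esub>"
    and "\<alpha> [^]\<^bsub>A\<^esub> s \<in> carrier A" and "(\<alpha> [^]\<^bsub>A\<^esub> s) [^]\<^bsub>A\<^esub> q = \<one>\<^bsub>A\<^esub>"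
proof -
  interpret A: comm_group A by fact
  have "\<alpha> [^]\<^bsub>A\<^esub> (s * s') = \<alpha> [^]\<^bsub>A\<^esub> (1 :: nat)"
    using s I.pow_mod_q[OF A \<alpha>, of "s * s'"] I.pow_mod_q[OF A \<alpha>, of 1] by (simp add: cong_def)
  then show "(\<alpha> [^]\<^bsub>A\<^esub> s') [^]\<^bsub>A\<^esub> s = \<alpha>"
    using \<alpha> by (simp add: A.nat_pow_pow mult.commute)
  have "(\<alpha> [^]\<^bsub>A\<^esub> k) [^]\<^bsub>A\<^esub> q = \<one>\<^bsub>A\<^esub>" for k :: nat
    using \<alpha> by (metis A.nat_pow_one A.nat_pow_pow mult.commute)
  then show "(\<alpha> [^]\<^bsub>A\<^esub> s') [^]\<^bsub>A\<^esub> q = \<one>\<^bsub>A\<^esub>" "(\<alpha> [^]\<^bsub>A\<^esub> s) [^]\<^bsub>A\<^esub> q = \<one>\<^bsub>A\<^esub>" by auto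
  show "\<alpha> [^]\<^bsub>A\<^esub> s' \<in> carrier A" "\<alpha> [^]\<^bsub>A\<^esub> s \<in> carrier A" using \<alpha> by auto
qed

text \<open>Both actions on the subgroups of \<open>P\<^sub>a \<oplus> P\<^sub>b\<close> have the same orbits.\<close>

lemma range_line_action:
  assumes W: "plane_subgroup p W"
  shows "range (\<lambda>j. {(x, y). (b ^ j * x, a ^ j * y) \<in> W}) =
    range (\<lambda>j. {(x, y). (d ^ j * x, c ^ j * y) \<in> W})"
proof -
  have eq: "{(x, y). (b ^ j * x, a ^ j * y) \<in> W} = {(x, y). (d ^ (s * j) * x, c ^ (s * j) * y) \<in> W}" for j
  proof -
    have sl: "[c ^ (s * j) * (b ^ j * x) = a ^ j * (d ^ (s * j) * x)] (mod int p)" for x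
      using cong_scalar_right[OF cong_pow[OF slopes, of j], of x]
      by (simp add: power_mult_distrib mult_ac flip: power_mult)
    have "(b ^ j * x, a ^ j * y) \<in> W \<longleftrightarrow> (c ^ (s * j) * (b ^ j * x), c ^ (s * j) * (a ^ j * y)) \<in> W" for x y
      by (rule plane_subgroup_scale_iff[OF W J.a_powers(2), symmetric])
    moreover have "\<dots> x y \<longleftrightarrow> (a ^ j * (d ^ (s * j) * x), a ^ j * (c ^ (s * j) * y)) \<in> W" for x y
      by (rule plane_subgroup_cong[OF W sl]) (simp add: mult_ac)
    moreover have "\<dots> x y \<longleftrightarrow> (d ^ (s * j) * x, c ^ (s * j) * y) \<in> W" for x y
      by (rule plane_subgroup_scale_iff[OF W I.a_powers(2)])
    ultimately show ?thesis by auto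
  qed
  have surj: "{(x, y). (d ^ j * x, c ^ j * y) \<in> W} = {(x, y). (d ^ (s * (s' * j)) * x, c ^ (s * (s' * j)) * y) \<in> W}" for j
  proof -
    have "[j = s * (s' * j)] (mod q)"
      using cong_scalar_right[OF s, of j] by (simp add: mult.assoc cong_sym)
    then have "[d ^ j * x = d ^ (s * (s' * j)) * x] (mod int p)" "[c ^ j * y = c ^ (s * (s' * j)) * y] (mod int p)" for x y
      using J.power_cong[OF J.a] J.power_cong[OF J.b] by (auto intro: cong_mult)
    then have "(d ^ j * x, c ^ j * y) \<in> W \<longleftrightarrow> (d ^ (s * (s' * j)) * x, c ^ (s * (s' * j)) * y) \<in> W" for x y
      by (rule plane_subgroup_cong[OF W])
    then show ?thesis by simp
  qed
  show ?thesis using eq surj by (auto simp: image_iff) metis+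
qed

theorem fibered_Burnside_rings_iso:
  fixes A :: "('c, 'm) monoid_scheme"
  assumes A: "comm_group A" and tors: "\<forall>\<alpha>\<in>carrier A. \<alpha> [^]\<^bsub>A\<^esub> p = \<one>\<^bsub>A\<^esub> \<longrightarrow> \<alpha> = \<one>\<^bsub>A\<^esub>"
  shows "fibered_Burnside_ring A I.G \<simeq> fibered_Burnside_ring A J.G"
proof (rule fibered_Burnside_ring_iso[OF I.G.is_group J.G.is_group I.finite_G A bij_f])
  let ?F = "fib_transport f (carrier I.G) :: _ \<Rightarrow> _ \<times> (_ \<Rightarrow> 'c)"
  show "?F ` fib_pairs I.G A = fib_pairs J.G A"
  proof (intro equalityI subsetI)
    fix y assume "y \<in> ?F ` fib_pairs I.G A"
    then obtain x where x: "x \<in> fib_pairs I.G A" "y = ?F x" by blast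
    show "y \<in> fib_pairs J.G A"
    proof (cases rule: I.fib_pairs_cases[OF A tors x(1), case_names planar split])
      case (planar W)
      then show ?thesis by (simp add: x(2) transport_planar_pair J.planar_pair_in_fib_pairs[OF A])
    next
      case (split U \<alpha> v w)
      then have "y = split_pair p q c d A U (\<alpha> [^]\<^bsub>A\<^esub> s') v w"
        using transport_split_pair[OF A split(1) pow_inverse_exponents(2,3)[OF A split(2,3)], of v w]
        by (simp add: x(2) pow_inverse_exponents(1)[OF A split(2,3)])
      then show ?thesis
        using J.split_pair_in_fib_pairs[OF A split(1) pow_inverse_exponents(2,3)[OF A split(2,3)]] by simp
    qed
  next
    fix y assume y: "y \<in> fib_pairs J.G A"
    show "y \<in> ?F ` fib_pairs I.G A"
    proof (cases rule: J.fib_pairs_cases[OF A tors y, case_names planar split])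
      case (planar W)
      then show ?thesis
        using I.planar_pair_in_fib_pairs[OF A planar(1)] transport_planar_pair by (metis imageI)
    next
      case (split U \<beta> v w)
      then show ?thesis
        using I.split_pair_in_fib_pairs[OF A split(1) pow_inverse_exponents(4,5)[OF A split(2,3)]]
          transport_split_pair[OF A split(1-3), of v w] by (metis imageI)
    qed
  qed
  show "?F ` fib_orbit I.G x = fib_orbit J.G (?F x)" if x: "x \<in> fib_pairs I.G A" for x
  proof (cases rule: I.fib_pairs_cases[OF A tors x, case_names planar split])
    case (planar W)
    have "?F ` fib_orbit I.G x = planar_pair p q A ` range (\<lambda>j. {(x, y). (b ^ j * x, a ^ j * y) \<in> W})"
      by (simp add: planar(2) I.orbit_planar_pair[OF planar(1)] image_image transport_planar_pair)
    also have "\<dots> = fib_orbit J.G (?F x)"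
      unfolding range_line_action[OF planar(1)]
      by (simp add: planar(2) J.orbit_planar_pair[OF planar(1)] image_image transport_planar_pair)
    finally show ?thesis .
  next
    case (split U \<alpha> v w)
    have F: "?F (split_pair p q a b A U \<alpha> v' w') = split_pair p q c d A U (\<alpha> [^]\<^bsub>A\<^esub> s') v' w'" for v' w'
      using transport_split_pair[OF A split(1) pow_inverse_exponents(2,3)[OF A split(2,3)], of v' w']
      by (simp add: pow_inverse_exponents(1)[OF A split(2,3)])
    show ?thesis
      by (simp add: split(4) F I.orbit_split_pair[OF split(1)] J.orbit_split_pair[OF split(1)]
          image_image case_prod_unfold)
  qed
qed

end

theorem theorem3p1:
  fixes p q :: nat and a b c d :: int and A :: "('a, 'm) monoid_scheme"
  assumes "prime p" and "prime q" and "q \<ge> 3" and "q dvd p - 1"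
    and "a \<in> Units (residue_ring (int p))" and "group.ord (units_of (residue_ring (int p))) a = q"
    and "b \<in> Units (residue_ring (int p))" and "group.ord (units_of (residue_ring (int p))) b = q"
    and "c \<in> Units (residue_ring (int p))" and "group.ord (units_of (residue_ring (int p))) c = q"
    and "d \<in> Units (residue_ring (int p))" and "group.ord (units_of (residue_ring (int p))) d = q"
    and "a \<noteq> b" and "c \<noteq> d"
    and "comm_group A"
    and "\<forall>\<alpha>\<in>carrier A. \<alpha> [^]\<^bsub>A\<^esub> p = \<one>\<^bsub>A\<^esub> \<longrightarrow> \<alpha> = \<one>\<^bsub>A\<^esub>"
  shows "fibered_Burnside_ring A (G_group p q a b) \<simeq> fibered_Burnside_ring A (G_group p q c d)"
proof -
  interpret I: planar_semidirect p q a b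
    using assms by unfold_locales auto
  interpret J: planar_semidirect p q c d
    using assms by unfold_locales auto
  have "[I.ratio ^ q = 1] (mod int p)" by (simp add: I.ratio_power_eq_1)
  then obtain s where s: "[I.ratio = J.ratio ^ s] (mod int p)"
    by (rule J.root_of_unity_ratio_power)
  have not_dvd: "\<not> q dvd s"
  proof
    assume "q dvd s"
    then have "[I.ratio ^ 1 = 1] (mod int p)"
      using s J.ratio_power_eq_1[of s] cong_trans by auto
    then show False
      using prime_gt_1_nat[OF assms(2)] unfolding I.ratio_power_eq_1 by simp
  qed
  then have "coprime s q"
    using prime_imp_coprime[OF assms(2)] coprime_commute by blast
  then obtain s' where s': "[s * s' = 1] (mod q)"
    using cong_solve_coprime_nat[of s q] by auto
  have slopes: "[b * c ^ s = a * d ^ s] (mod int p)"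
  proof -
    have "[b ^ 1 * c ^ s = (I.ratio ^ 1 * a ^ 1) * c ^ s] (mod int p)"
      by (intro cong_mult cong_refl cong_sym[OF I.ratio_power])
    also have "[I.ratio ^ 1 * a ^ 1 * c ^ s = J.ratio ^ s * a * c ^ s] (mod int p)"
      using s by (auto intro!: cong_mult)
    also have "J.ratio ^ s * a * c ^ s = a * (J.ratio ^ s * c ^ s)" by simp
    also have "[a * (J.ratio ^ s * c ^ s) = a * d ^ s] (mod int p)"
      by (intro cong_mult cong_refl J.ratio_power)
    finally show ?thesis by simp
  qed
  have dvd: "q dvd s * n \<longleftrightarrow> q dvd n" for n
    using not_dvd assms(2) by (simp add: prime_dvd_mult_iff)
  have "\<forall>n. \<exists>r. coprime r (int p) \<and> [r * (1 - a ^ n) = 1 - c ^ (s * n)] (mod int p) \<and> (q dvd n \<longrightarrow> r = 1)"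
    "\<forall>n. \<exists>r. coprime r (int p) \<and> [r * (1 - b ^ n) = 1 - d ^ (s * n)] (mod int p) \<and> (q dvd n \<longrightarrow> r = 1)"
    using exists_cong_quotient[OF assms(1)] I.a_powers(1) I.b_powers(1) J.a_powers(1) J.b_powers(1) dvd
    by metis+
  then obtain r r' where r: "\<And>n. coprime (r n) (int p)"
      "\<And>n. [r n * (1 - a ^ n) = 1 - c ^ (s * n)] (mod int p)" "\<And>n. q dvd n \<Longrightarrow> r n = 1"
    and r': "\<And>n. coprime (r' n) (int p)"
      "\<And>n. [r' n * (1 - b ^ n) = 1 - d ^ (s * n)] (mod int p)" "\<And>n. q dvd n \<Longrightarrow> r' n = 1"
    by metis
  interpret planar_semidirect_pair p q a b c d s s' r r'
    using s' slopes r r' by unfold_locales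
  show ?thesis
    by (rule fibered_Burnside_rings_iso[OF assms(15,16)])
qed

end
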